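(* Let $G$ be a finite nonnilpotent group and let $\alpha$ be a faithful action of $G$ on a finite set $S$. Let $G^0=G\cup\{0\}$ and $S^0=S\cup\{0\}$ (each with a new element $0$), and define $\alpha^0:G^0\times S^0\to S^0$ by $\alpha^0(g,x)=gx$ if $g\in G$, $x\in S$, and $\alpha^0(g,x)=0$ otherwise. Let $\mathbf{C}$ be the algebra with universe $G^0\times S^0$ and two basic operations: a unary operation $f((g,x))=(g,\alpha^0(g,x))$ and a binary operation $d((g_1,x_1),(g_2,x_2))=(g_1,x_2)$. Then $\mathbf{C}$ is inherently nonfinitely based in the finite sense: for every $n\geq 1$ there exists $d\geq 1$ such that $\mathscr{V}(\mathbf{C})^{(n)}$ contains arbitrarily large finite $d$-generated algebras.
   Context: For a finite algebra $\mathbf{A}$ (with finitely many basic operations) and $n\geq 1$, $\mathscr{V}(\mathbf{A})^{(n)}$ denotes the class of all algebras (in the same signature) satisfying every identity in at most $n$ variables that is valid in $\mathbf{A}$. "Arbitrarily large finite $d$-generated algebras" means: for every $\ell>0$ there is a finite algebra in the class, generated by at most $d$ elements, with at least $\ell$ elements. (In the paper $\mathbf{C}$ is denoted $\mathbb{A}_0(G,S,\alpha)^\ast$.) *)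

theory Defs
  imports "HOL-Algebra.Group_Action" "HOL-Algebra.Generated_Groups"
begin

section \<open>Nilpotent groups\<close>

definition commutator_subgroup :: "('a, 'm) monoid_scheme \<Rightarrow> 'a set \<Rightarrow> 'a set \<Rightarrow> 'a set" where
  "commutator_subgroup G H K =
     generate G {h \<otimes>\<^bsub>G\<^esub> k \<otimes>\<^bsub>G\<^esub> inv\<^bsub>G\<^esub> h \<otimes>\<^bsub>G\<^esub> inv\<^bsub>G\<^esub> k | h k. h \<in> H \<and> k \<in> K}"

primrec lower_central_series :: "('a, 'm) monoid_scheme \<Rightarrow> nat \<Rightarrow> 'a set" where
  "lower_central_series G 0 = carrier G"
| "lower_central_series G (Suc i) = commutator_subgroup G (lower_central_series G i) (carrier G)"

definition nilpotent_group :: "('a, 'm) monoid_scheme \<Rightarrow> bool" where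
  "nilpotent_group G \<longleftrightarrow> group G \<and> (\<exists>c. lower_central_series G c = {\<one>\<^bsub>G\<^esub>})"

section \<open>Algebras, terms and identities\<close>

text \<open>
  A signature is an arity function on a type \<open>'f\<close> of operation symbols. The value of
  \<open>op_of A F xs\<close> is relevant only if \<open>xs\<close> is a list over the universe whose length is
  the arity of \<open>F\<close>.
\<close>

record ('f, 'a) ualgebra =
  universe :: "'a set"
  op_of :: "'f \<Rightarrow> 'a list \<Rightarrow> 'a"

definition is_ualgebra :: "('f \<Rightarrow> nat) \<Rightarrow> ('f, 'a) ualgebra \<Rightarrow> bool" where
  "is_ualgebra ar A \<longleftrightarrow> universe A \<noteq> {} \<and>
     (\<forall>F xs. length xs = ar F \<and> set xs \<subseteq> universe A \<longrightarrow> op_of A F xs \<in> universe A)"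

datatype ('f, 'v) uterm = Var 'v | App 'f "('f, 'v) uterm list"

primrec wf_uterm :: "('f \<Rightarrow> nat) \<Rightarrow> ('f, 'v) uterm \<Rightarrow> bool" where
  "wf_uterm ar (Var v) \<longleftrightarrow> True"
| "wf_uterm ar (App F ts) \<longleftrightarrow> length ts = ar F \<and> list_all (wf_uterm ar) ts"

primrec uterm_vars :: "('f, 'v) uterm \<Rightarrow> 'v set" where
  "uterm_vars (Var v) = {v}"
| "uterm_vars (App F ts) = \<Union> (set (map uterm_vars ts))"

primrec eval_uterm :: "('f, 'a) ualgebra \<Rightarrow> ('v \<Rightarrow> 'a) \<Rightarrow> ('f, 'v) uterm \<Rightarrow> 'a" where
  "eval_uterm A \<rho> (Var v) = \<rho> v"
| "eval_uterm A \<rho> (App F ts) = op_of A F (map (eval_uterm A \<rho>) ts)"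

definition satisfies_identity ::
    "('f, 'a) ualgebra \<Rightarrow> ('f, 'v) uterm \<Rightarrow> ('f, 'v) uterm \<Rightarrow> bool" where
  "satisfies_identity A s t \<longleftrightarrow>
     (\<forall>\<rho>. range \<rho> \<subseteq> universe A \<longrightarrow> eval_uterm A \<rho> s = eval_uterm A \<rho> t)"

text \<open>
  \<open>in_variety_upto ar n A B\<close> expresses that \<open>B\<close> belongs to
  \<open>V(A)\<^sup>(\<^sup>n\<^sup>)\<close>, the class of all algebras satisfying the identities in at most \<open>n\<close> variables
  valid in \<open>A\<close>.
\<close>

definition in_variety_upto ::
    "('f \<Rightarrow> nat) \<Rightarrow> nat \<Rightarrow> ('f, 'a) ualgebra \<Rightarrow> ('f, 'b) ualgebra \<Rightarrow> bool" where
  "in_variety_upto ar n A B \<longleftrightarrow> is_ualgebra ar B \<and>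
     (\<forall>(s :: ('f, nat) uterm) t.
        wf_uterm ar s \<and> wf_uterm ar t \<and> card (uterm_vars s \<union> uterm_vars t) \<le> n \<and>
        satisfies_identity A s t \<longrightarrow> satisfies_identity B s t)"

inductive_set subuniverse_generated ::
    "('f \<Rightarrow> nat) \<Rightarrow> ('f, 'a) ualgebra \<Rightarrow> 'a set \<Rightarrow> 'a set"
  for ar :: "'f \<Rightarrow> nat" and A :: "('f, 'a) ualgebra" and X :: "'a set" where
  gen: "x \<in> X \<Longrightarrow> x \<in> subuniverse_generated ar A X"
| app: "length xs = ar F \<Longrightarrow> \<forall>x\<in>set xs. x \<in> subuniverse_generated ar A X \<Longrightarrow>
          op_of A F xs \<in> subuniverse_generated ar A X"

definition generated_by_at_most :: "('f \<Rightarrow> nat) \<Rightarrow> ('f, 'a) ualgebra \<Rightarrow> nat \<Rightarrow> bool" where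
  "generated_by_at_most ar A d \<longleftrightarrow>
     (\<exists>X. X \<subseteq> universe A \<and> finite X \<and> card X \<le> d \<and> subuniverse_generated ar A X = universe A)"

text \<open>
  The quantification over finite algebras \<open>B\<close> is over algebras whose universe is a finite set of
  natural numbers; this loses nothing, since every finite algebra is isomorphic to such an algebra
  and all properties involved are invariant under isomorphism.
\<close>

definition inherently_nonfinitely_based_in_finite_sense ::
    "('f \<Rightarrow> nat) \<Rightarrow> ('f, 'a) ualgebra \<Rightarrow> bool" where
  "inherently_nonfinitely_based_in_finite_sense ar A \<longleftrightarrow>
     (\<forall>n\<ge>1. \<exists>d\<ge>1. \<forall>l>0. \<exists>B :: ('f, nat) ualgebra.
        in_variety_upto ar n A B \<and> finite (universe B) \<and>
        generated_by_at_most ar B d \<and> l \<le> card (universe B))"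

section \<open>The algebra of a group action\<close>

text \<open>The adjoined element 0 is \<open>None\<close>, both for \<open>G\<close> and for \<open>S\<close>.\<close>

definition with_zero :: "'a set \<Rightarrow> 'a option set" where
  "with_zero X = insert None (Some ` X)"

fun action_zero :: "('g \<Rightarrow> 's \<Rightarrow> 's) \<Rightarrow> 'g option \<Rightarrow> 's option \<Rightarrow> 's option" where
  "action_zero \<alpha> (Some g) (Some x) = Some (\<alpha> g x)"
| "action_zero \<alpha> _ _ = None"

datatype fd_symbol = Sym_f | Sym_d

primrec fd_arity :: "fd_symbol \<Rightarrow> nat" where
  "fd_arity Sym_f = 1"
| "fd_arity Sym_d = 2"

definition action_f ::
    "('g \<Rightarrow> 's \<Rightarrow> 's) \<Rightarrow> 'g option \<times> 's option \<Rightarrow> 'g option \<times> 's option" where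
  "action_f \<alpha> p = (fst p, action_zero \<alpha> (fst p) (snd p))"

definition action_d ::
    "'g option \<times> 's option \<Rightarrow> 'g option \<times> 's option \<Rightarrow> 'g option \<times> 's option" where
  "action_d p q = (fst p, snd q)"

definition action_algebra ::
    "('g, 'm) monoid_scheme \<Rightarrow> 's set \<Rightarrow> ('g \<Rightarrow> 's \<Rightarrow> 's) \<Rightarrow>
     (fd_symbol, 'g option \<times> 's option) ualgebra" where
  "action_algebra G S \<alpha> =
     \<lparr>universe = with_zero (carrier G) \<times> with_zero S,
      op_of = (\<lambda>F xs. case F of
         Sym_f \<Rightarrow> action_f \<alpha> (xs ! 0)
       | Sym_d \<Rightarrow> action_d (xs ! 0) (xs ! 1))\<rparr>"

lemma is_ualgebra_action_algebra:
  fixes G :: "('g, 'm) monoid_scheme" and S :: "'s set"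
  assumes "group_action G S \<alpha>"
  shows "is_ualgebra fd_arity (action_algebra G S \<alpha>)"
proof -
  have cl: "\<alpha> g x \<in> S" if "g \<in> carrier G" "x \<in> S" for g x
    using group_action.element_image[OF assms that] by simp
  have 1: "action_f \<alpha> p \<in> with_zero (carrier G) \<times> with_zero S"
    if "p \<in> with_zero (carrier G) \<times> with_zero S" for p
    using that by (auto simp: action_f_def with_zero_def inj_image_mem_iff cl)
  have 2: "action_d p q \<in> with_zero (carrier G) \<times> with_zero S"
    if "p \<in> with_zero (carrier G) \<times> with_zero S" "q \<in> with_zero (carrier G) \<times> with_zero S"
    for p q :: "'g option \<times> 's option"
    using that by (auto simp: action_d_def)
  show ?thesis
    unfolding is_ualgebra_def
  proof (intro conjI allI impI)
    show "universe (action_algebra G S \<alpha>) \<noteq> {}"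
      by (auto simp: action_algebra_def with_zero_def)
  next
    fix F xs
    assume h: "length xs = fd_arity F \<and> set xs \<subseteq> universe (action_algebra G S \<alpha>)"
    show "op_of (action_algebra G S \<alpha>) F xs \<in> universe (action_algebra G S \<alpha>)"
    proof (cases F)
      case Sym_f
      then have "xs ! 0 \<in> set xs" using h by simp
      then have "xs ! 0 \<in> with_zero (carrier G) \<times> with_zero S"
        using h by (auto simp: action_algebra_def)
      from 1[OF this] show ?thesis using Sym_f by (simp add: action_algebra_def)
    next
      case Sym_d
      then have "xs ! 0 \<in> set xs" "xs ! 1 \<in> set xs" using h by simp_all
      then have "xs ! 0 \<in> with_zero (carrier G) \<times> with_zero S"
        "xs ! 1 \<in> with_zero (carrier G) \<times> with_zero S"
        using h by (auto simp: action_algebra_def)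
      from 2[OF this] show ?thesis using Sym_d by (simp add: action_algebra_def)
    qed
  qed
qed

end

theory Submission
  imports Defs "HOL-Algebra.Sylow" "HOL-Algebra.Multiplicative_Group" "HOL-Number_Theory.Cong"
begin

text \<open>
  Terms over the two operations amount to a head variable, a word of variables acting, and a tail
  variable, so the identities of the algebra yield the word identities of \<open>G\<close>. For given \<open>n\<close>
  it suffices to find, with a fixed number of letters, transitive actions on arbitrarily large
  finite sets in which any \<open>n\<close> of the letters satisfy the word identities of \<open>G\<close>.

  A finite nonnilpotent group has a section with an elementary abelian normal \<open>p\<close>-subgroup on which
  an element of \<open>q\<close>-power order, \<open>q \<noteq> p\<close>, acts nontrivially. By Fourier inversion every
  word identity of \<open>G\<close> therefore holds in \<open>C\<^sub>p wr C\<^sub>q\<^sup>n\<close>. Now take \<open>D wr C\<^sub>q\<^sup>n\<close>, where \<open>D\<close> is a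
  large finite group generated by two elements \<open>s\<close>, \<open>t\<close> of order \<open>p\<close>, with the letters \<open>X\<close> (\<open>s\<close> at
  coordinate \<open>0\<close>), \<open>Y\<close> (\<open>t\<close> at coordinate \<open>(1,\<dots>,1)\<close>) and the \<open>n\<close> generators \<open>Z i\<close> of \<open>C\<^sub>q\<^sup>n\<close>.
  Together they generate a group involving \<open>D\<close>, but as soon as one letter is omitted,
  the conjugates of \<open>X\<close> and \<open>Y\<close> that occur commute.
\<close>

section \<open>Finite nilpotent groups\<close>

text \<open>In a finite nilpotent group elements of coprime order commute; a nontrivial coprime
  action is therefore what nonnilpotency has to supply. It is found in a quotient of a minimal
  nonnilpotent subgroup that has trivial centre and nilpotent proper subgroups. Simplicity is the
  obstacle there: a simple group offers no normal \<open>p\<close>-subgroup to act on. It is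
  excluded by counting conjugates of maximal subgroups. A proper normal subgroup is then nilpotent,
  and the elements of exponent \<open>p\<close> in its centre form the required subgroup; trivial
  centre prevents all elements of order prime to \<open>p\<close> from centralising it.

  The role of a root of unity is played by the conjugates of a commutator of \<open>g\<close> and
  \<open>a0\<close> rather than of \<open>a0\<close> itself, since their product over a period
  telescopes to 1. Fourier inversion divides by powers of \<open>q\<close> in a group of exponent
  \<open>p\<close>, which is possible as the primes differ.

  On any proper set of letters the witnesses use no relations between \<open>s\<close> and
  \<open>t\<close>, only that both have \<open>p\<close>-th power 1. Nothing therefore bounds the
  number of points on which they act.\<close>

context group
begin

lemma lower_central_series_subset: "lower_central_series G i \<subseteq> carrier G"
proof (induction i)
  case (Suc i)
  then have "{h \<otimes> k \<otimes> inv h \<otimes> inv k |h k. h \<in> lower_central_series G i \<and> k \<in> carrier G} \<subseteq> carrier G"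
    by auto
  then show ?case by (auto simp: commutator_subgroup_def dest: generate_in_carrier)
qed simp

lemma commutator_in_lower_central_series:
  "h \<in> lower_central_series G i \<Longrightarrow> k \<in> carrier G \<Longrightarrow>
     h \<otimes> k \<otimes> inv h \<otimes> inv k \<in> lower_central_series G (Suc i)"
  by (auto simp: commutator_subgroup_def intro: generate.incl)

lemma one_in_lower_central_series: "\<one> \<in> lower_central_series G i"
  by (cases i) (auto simp: commutator_subgroup_def intro: generate.one)

lemma lower_central_series_SucI:
  assumes "subgroup M G" "\<And>h k. h \<in> lower_central_series G i \<Longrightarrow> k \<in> carrier G \<Longrightarrow>
     h \<otimes> k \<otimes> inv h \<otimes> inv k \<in> M"
  shows "lower_central_series G (Suc i) \<subseteq> M"
  unfolding lower_central_series.simps commutator_subgroup_def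
  by (rule generate_subgroup_incl[OF _ assms(1)]) (use assms(2) in blast)

text \<open>The lower central series enters \<open>H\<close> at some term, and not at the whole
  group. An element \<open>z\<close> of the preceding term outside \<open>H\<close> normalizes
  \<open>H\<close>, because its commutators with elements of \<open>H\<close> lie in the term
  already inside \<open>H\<close>.\<close>

lemma nilpotent_normalizer_condition:
  assumes "nilpotent_group G" "subgroup H G" "H \<noteq> carrier G"
  obtains z where "z \<in> carrier G" "z \<notin> H" "\<And>x. x \<in> H \<Longrightarrow> z \<otimes> x \<otimes> inv z \<in> H"
proof -
  obtain c where c: "lower_central_series G c = {\<one>}"
    using assms(1) unfolding nilpotent_group_def by blast
  then have "lower_central_series G c \<subseteq> H" using assms(2) subgroup.one_closed by auto
  define i where "i = (LEAST i. lower_central_series G i \<subseteq> H)"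
  have i: "lower_central_series G i \<subseteq> H"
    unfolding i_def by (rule LeastI) fact
  have "i \<noteq> 0" using i assms(2,3) subgroup.subset by (metis lower_central_series.simps(1) subset_antisym)
  then obtain j where j: "i = Suc j" by (cases i) auto
  then have "\<not> lower_central_series G j \<subseteq> H"
    using not_less_Least[of j "\<lambda>i. lower_central_series G i \<subseteq> H"] unfolding i_def by simp
  then obtain z where z: "z \<in> lower_central_series G j" "z \<notin> H" by auto
  then have zc: "z \<in> carrier G" using lower_central_series_subset by auto
  show thesis
  proof (rule that[OF zc z(2)])
    fix x assume x: "x \<in> H"
    then have xc: "x \<in> carrier G" using assms(2) subgroup.mem_carrier by metis
    have "z \<otimes> x \<otimes> inv z \<otimes> inv x \<in> H"
      using commutator_in_lower_central_series[OF z(1) xc] i j by auto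
    then have "z \<otimes> x \<otimes> inv z \<otimes> inv x \<otimes> x \<in> H" using x assms(2) subgroup.m_closed by metis
    then show "z \<otimes> x \<otimes> inv z \<in> H" using zc xc by (simp add: m_assoc)
  qed
qed

text \<open>The last nontrivial term of the lower central series is central.\<close>

lemma nilpotent_center_nontrivial:
  assumes "nilpotent_group G" "carrier G \<noteq> {\<one>}"
  obtains z where "z \<in> carrier G" "z \<noteq> \<one>" "\<And>x. x \<in> carrier G \<Longrightarrow> z \<otimes> x = x \<otimes> z"
proof -
  obtain c where c: "lower_central_series G c = {\<one>}"
    using assms(1) unfolding nilpotent_group_def by blast
  define i where "i = (LEAST i. lower_central_series G i = {\<one>})"
  have i: "lower_central_series G i = {\<one>}"
    unfolding i_def by (rule LeastI) fact
  have "i \<noteq> 0" using i assms(2) by (metis lower_central_series.simps(1))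
  then obtain j where j: "i = Suc j" by (cases i) auto
  then have "lower_central_series G j \<noteq> {\<one>}"
    using not_less_Least[of j "\<lambda>i. lower_central_series G i = {\<one>}"] unfolding i_def by simp
  then obtain z where z: "z \<in> lower_central_series G j" "z \<noteq> \<one>"
    using one_in_lower_central_series by blast
  then have zc: "z \<in> carrier G" using lower_central_series_subset by auto
  show thesis
  proof (rule that[OF zc z(2)])
    fix x assume x: "x \<in> carrier G"
    have "z \<otimes> x \<otimes> inv z \<otimes> inv x = \<one>"
      using commutator_in_lower_central_series[OF z(1) x] i j by auto
    then have "z \<otimes> x \<otimes> inv (x \<otimes> z) = \<one>" using zc x by (simp add: m_assoc inv_mult_group)
    then show "z \<otimes> x = x \<otimes> z" using zc x by (metis inv_closed inv_inv inv_equality m_closed)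
  qed
qed

end

lemma nilpotent_group_hom_image:
  assumes h: "group_hom G H h" and surj: "h ` carrier G = carrier H" and nil: "nilpotent_group G"
  shows "nilpotent_group H"
proof -
  interpret group_hom G H h by (rule h)
  have sub: "lower_central_series H i \<subseteq> h ` lower_central_series G i" for i
  proof (induction i)
    case 0
    then show ?case using surj by simp
  next
    case (Suc i)
    let ?K = "{x \<otimes>\<^bsub>G\<^esub> k \<otimes>\<^bsub>G\<^esub> inv\<^bsub>G\<^esub> x \<otimes>\<^bsub>G\<^esub> inv\<^bsub>G\<^esub> k |x k. x \<in> lower_central_series G i \<and> k \<in> carrier G}"
    have "?K \<subseteq> carrier G" using G.lower_central_series_subset[of i] by auto
    then have gen: "generate H (h ` ?K) = h ` lower_central_series G (Suc i)"
      using generate_img by (simp add: commutator_subgroup_def)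
    have "{x \<otimes>\<^bsub>H\<^esub> k \<otimes>\<^bsub>H\<^esub> inv\<^bsub>H\<^esub> x \<otimes>\<^bsub>H\<^esub> inv\<^bsub>H\<^esub> k |x k. x \<in> lower_central_series H i \<and> k \<in> carrier H} \<subseteq> h ` ?K"
    proof
      fix y
      assume "y \<in> {x \<otimes>\<^bsub>H\<^esub> k \<otimes>\<^bsub>H\<^esub> inv\<^bsub>H\<^esub> x \<otimes>\<^bsub>H\<^esub> inv\<^bsub>H\<^esub> k |x k. x \<in> lower_central_series H i \<and> k \<in> carrier H}"
      then obtain x k where y: "y = x \<otimes>\<^bsub>H\<^esub> k \<otimes>\<^bsub>H\<^esub> inv\<^bsub>H\<^esub> x \<otimes>\<^bsub>H\<^esub> inv\<^bsub>H\<^esub> k"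
        "x \<in> lower_central_series H i" "k \<in> carrier H" by blast
      from y(2) Suc obtain x' where x': "x = h x'" "x' \<in> lower_central_series G i" by blast
      from y(3) surj obtain k' where k': "k = h k'" "k' \<in> carrier G" by blast
      have "x' \<in> carrier G" using x' G.lower_central_series_subset by blast
      then have "y = h (x' \<otimes>\<^bsub>G\<^esub> k' \<otimes>\<^bsub>G\<^esub> inv\<^bsub>G\<^esub> x' \<otimes>\<^bsub>G\<^esub> inv\<^bsub>G\<^esub> k')" using y x' k' by simp
      then show "y \<in> h ` ?K" using x'(2) k'(2) by blast
    qed
    from H.mono_generate[OF this] show ?case using gen by (simp add: commutator_subgroup_def)
  qed
  obtain c where "lower_central_series G c = {\<one>\<^bsub>G\<^esub>}"
    using nil unfolding nilpotent_group_def by blast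
  then have "lower_central_series H c = {\<one>\<^bsub>H\<^esub>}"
    using sub[of c] H.one_in_lower_central_series[of c] by auto
  then show ?thesis unfolding nilpotent_group_def using H.is_group by blast
qed

section \<open>A centreless section all of whose proper subgroups are nilpotent\<close>

text \<open>Together with nonnilpotency this describes the Schmidt groups. It is kept separate
  because it passes to homomorphic images on its own.\<close>

definition proper_subgroups_nilpotent :: "('a, 'm) monoid_scheme \<Rightarrow> bool" where
  "proper_subgroups_nilpotent G \<longleftrightarrow>
     (\<forall>H. subgroup H G \<longrightarrow> H \<noteq> carrier G \<longrightarrow> nilpotent_group (G\<lparr>carrier := H\<rparr>))"

definition centreless :: "('a, 'm) monoid_scheme \<Rightarrow> bool" where
  "centreless G \<longleftrightarrow>
     (\<forall>z\<in>carrier G. (\<forall>x\<in>carrier G. z \<otimes>\<^bsub>G\<^esub> x = x \<otimes>\<^bsub>G\<^esub> z) \<longrightarrow> z = \<one>\<^bsub>G\<^esub>)"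

lemma (in group) minimal_nonnilpotent_subgroup:
  assumes fin: "finite (carrier G)" and "\<not> nilpotent_group G"
  obtains H where "subgroup H G" "\<not> nilpotent_group (G\<lparr>carrier := H\<rparr>)"
    "proper_subgroups_nilpotent (G\<lparr>carrier := H\<rparr>)"
proof -
  let ?P = "\<lambda>H. subgroup H G \<and> \<not> nilpotent_group (G\<lparr>carrier := H\<rparr>)"
  have "?P (carrier G)" using assms(2) subgroup_self by simp
  then obtain H where H: "?P H" "\<And>K. ?P K \<Longrightarrow> card H \<le> card K"
    using ex_has_least_nat[of ?P "carrier G" card] by blast
  have "nilpotent_group (G\<lparr>carrier := H\<rparr>\<lparr>carrier := K\<rparr>)"
    if K: "subgroup K (G\<lparr>carrier := H\<rparr>)" "K \<noteq> H" for K
  proof (rule ccontr)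
    assume "\<not> nilpotent_group (G\<lparr>carrier := H\<rparr>\<lparr>carrier := K\<rparr>)"
    then have "?P K" using incl_subgroup[OF _ K(1)] H(1) by simp
    then have "card H \<le> card K" by (rule H(2))
    moreover have "K \<subseteq> H" using K(1) subgroup.subset by fastforce
    moreover have "finite H" using H(1) fin subgroup.subset finite_subset by metis
    ultimately show False using K(2) by (metis card_seteq)
  qed
  then have "proper_subgroups_nilpotent (G\<lparr>carrier := H\<rparr>)"
    by (simp add: proper_subgroups_nilpotent_def)
  then show thesis using that H(1) by blast
qed

lemma (in group_hom) centre_preimage_subgroup:
  "subgroup {y \<in> carrier G. \<forall>x\<in>carrier H. h y \<otimes>\<^bsub>H\<^esub> x = x \<otimes>\<^bsub>H\<^esub> h y} G" (is "subgroup ?K G")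
proof (rule G.subgroupI)
  show "?K \<subseteq> carrier G" by auto
  have "\<one> \<in> ?K" by simp
  then show "?K \<noteq> {}" by blast
next
  fix a assume a: "a \<in> ?K"
  then have ac: "a \<in> carrier G" by simp
  have "inv\<^bsub>H\<^esub> (h a) \<otimes>\<^bsub>H\<^esub> x = x \<otimes>\<^bsub>H\<^esub> inv\<^bsub>H\<^esub> (h a)" if x: "x \<in> carrier H" for x
  proof -
    have "h a \<otimes>\<^bsub>H\<^esub> x = x \<otimes>\<^bsub>H\<^esub> h a" using a x by simp
    then have "x = inv\<^bsub>H\<^esub> (h a) \<otimes>\<^bsub>H\<^esub> (x \<otimes>\<^bsub>H\<^esub> h a)"
      using ac x by (metis H.inv_solve_left H.m_closed hom_closed)
    then have "x = inv\<^bsub>H\<^esub> (h a) \<otimes>\<^bsub>H\<^esub> x \<otimes>\<^bsub>H\<^esub> h a" using ac x by (simp add: H.m_assoc)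
    then show ?thesis using ac x by (metis H.inv_closed H.inv_solve_right H.m_closed hom_closed)
  qed
  then show "inv a \<in> ?K" using ac by simp
next
  fix a b assume ab: "a \<in> ?K" "b \<in> ?K"
  then have c: "a \<in> carrier G" "b \<in> carrier G" by simp_all
  have "(h a \<otimes>\<^bsub>H\<^esub> h b) \<otimes>\<^bsub>H\<^esub> x = x \<otimes>\<^bsub>H\<^esub> (h a \<otimes>\<^bsub>H\<^esub> h b)" if "x \<in> carrier H" for x
  proof -
    have "h a \<otimes>\<^bsub>H\<^esub> x = x \<otimes>\<^bsub>H\<^esub> h a" "h b \<otimes>\<^bsub>H\<^esub> x = x \<otimes>\<^bsub>H\<^esub> h b" using ab that by auto
    then show ?thesis using that c by (metis H.m_assoc hom_closed)
  qed
  then show "a \<otimes> b \<in> ?K" using c by simp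
qed

lemma (in group_hom) commutator_of_centre_preimage:
  assumes "y \<in> {y \<in> carrier G. \<forall>x\<in>carrier H. h y \<otimes>\<^bsub>H\<^esub> x = x \<otimes>\<^bsub>H\<^esub> h y}" "k \<in> carrier G"
  shows "h (y \<otimes> k \<otimes> inv y \<otimes> inv k) = \<one>\<^bsub>H\<^esub>"
proof -
  have yc: "y \<in> carrier G" using assms(1) by simp
  have "h (y \<otimes> k \<otimes> inv y \<otimes> inv k) = (h y \<otimes>\<^bsub>H\<^esub> h k) \<otimes>\<^bsub>H\<^esub> inv\<^bsub>H\<^esub> (h k \<otimes>\<^bsub>H\<^esub> h y)"
    using assms(2) yc by (simp add: H.m_assoc H.inv_mult_group)
  also have "h k \<otimes>\<^bsub>H\<^esub> h y = h y \<otimes>\<^bsub>H\<^esub> h k" using assms by simp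
  finally show ?thesis using assms by simp
qed

lemma (in group_hom) proper_subgroups_nilpotent_image:
  assumes surj: "h ` carrier G = carrier H" and psn: "proper_subgroups_nilpotent G"
  shows "proper_subgroups_nilpotent H"
  unfolding proper_subgroups_nilpotent_def
proof (intro allI impI)
  fix L assume L: "subgroup L H" "L \<noteq> carrier H"
  define K where "K = {x \<in> carrier G. h x \<in> L}"
  have Lc: "L \<subseteq> carrier H" using L(1) by (rule subgroup.subset)
  have subK: "subgroup K G"
  proof (rule G.subgroupI)
    have "\<one> \<in> K" using subgroup.one_closed[OF L(1)] by (simp add: K_def)
    then show "K \<noteq> {}" by blast
  qed (auto simp: K_def subgroup.m_closed[OF L(1)] subgroup.m_inv_closed[OF L(1)])
  have img: "h ` K = L" using Lc surj by (auto simp: K_def)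
  then have "K \<noteq> carrier G" using L(2) surj by auto
  then have nil: "nilpotent_group (G\<lparr>carrier := K\<rparr>)"
    using psn subK unfolding proper_subgroups_nilpotent_def by blast
  have "h \<in> hom (G\<lparr>carrier := K\<rparr>) (H\<lparr>carrier := L\<rparr>)"
    by (auto simp: hom_def K_def)
  then have "group_hom (G\<lparr>carrier := K\<rparr>) (H\<lparr>carrier := L\<rparr>) h"
    using G.subgroup_imp_group[OF subK] H.subgroup_imp_group[OF L(1)]
    by (simp add: group_hom_def group_hom_axioms_def)
  then show "nilpotent_group (H\<lparr>carrier := L\<rparr>)"
    by (rule nilpotent_group_hom_image) (simp_all add: img nil)
qed

text \<open>\<open>M\<close> is maximal among the normal subgroups with nonnilpotent quotient. For
  the preimage \<open>K\<close> of the centre of the quotient, the commutators of \<open>K\<close>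
  with \<open>G\<close> lie in \<open>M\<close>; a term of the lower central series inside
  \<open>K\<close> would put the next one inside \<open>M\<close>. Hence \<open>K\<close> has
  nonnilpotent quotient as well, and maximality gives \<open>K = M\<close>.\<close>

lemma (in group) centreless_quotient:
  assumes fin: "finite (carrier G)" and nn: "\<not> nilpotent_group G"
    and psn: "proper_subgroups_nilpotent G"
  obtains M where "M \<lhd> G" "carrier (G Mod M) \<noteq> {\<one>\<^bsub>G Mod M\<^esub>}" "centreless (G Mod M)"
    "proper_subgroups_nilpotent (G Mod M)"
proof -
  \<comment> \<open>Nonnilpotency of \<open>G Mod M\<close>, expressed inside
    \<open>G\<close>.\<close>
  let ?P = "\<lambda>M. M \<lhd> G \<and> (\<forall>c. \<not> lower_central_series G c \<subseteq> M)"
  have P1: "?P {\<one>}"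
  proof (intro conjI allI notI)
    show "{\<one>} \<lhd> G" by (rule one_is_normal)
    fix c assume "lower_central_series G c \<subseteq> {\<one>}"
    then have "lower_central_series G c = {\<one>}" using one_in_lower_central_series by blast
    then show False using nn is_group unfolding nilpotent_group_def by blast
  qed
  have sub: "M \<subseteq> carrier G" if "?P M" for M
    using that normal_imp_subgroup subgroup.subset by blast
  then have "\<forall>M. ?P M \<longrightarrow> card M < Suc (order G)"
    unfolding order_def using card_mono[OF fin] less_Suc_eq_le by presburger
  from ex_has_greatest_nat[of ?P, OF P1 this]
  obtain M where M: "?P M" "\<And>K. ?P K \<Longrightarrow> card K \<le> card M"
    by (elim exE conjE) presburger
  have norm: "M \<lhd> G" using M(1) by blast
  interpret M: normal M G by (rule norm)
  have Mc: "M \<subseteq> carrier G" by (rule M.subset)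
  let ?Q = "G Mod M" and ?\<pi> = "\<lambda>x. M #> x"
  interpret \<pi>: group_hom G ?Q ?\<pi>
    using M.r_coset_hom_Mod M.factorgroup_is_group by (simp add: group_hom_def group_hom_axioms_def is_group)
  have surj: "?\<pi> ` carrier G = carrier ?Q" by (auto simp: FactGroup_def RCOSETS_def)
  have one: "M #> x = M \<longleftrightarrow> x \<in> M" if "x \<in> carrier G" for x
    using that M.is_subgroup coset_join1 coset_join2 by blast
  have oneQ: "\<one>\<^bsub>?Q\<^esub> = M" by (simp add: FactGroup_def)
  have "carrier ?Q \<noteq> {\<one>\<^bsub>?Q\<^esub>}"
  proof
    assume "carrier ?Q = {\<one>\<^bsub>?Q\<^esub>}"
    then have "?\<pi> x = M" if "x \<in> carrier G" for x using \<pi>.hom_closed[OF that] oneQ by simp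
    then have "lower_central_series G 0 \<subseteq> M" using one by auto
    then show False using M(1) by blast
  qed
  moreover have "centreless ?Q"
    unfolding centreless_def
  proof (intro ballI impI)
    fix z assume z: "z \<in> carrier ?Q" "\<forall>x\<in>carrier ?Q. z \<otimes>\<^bsub>?Q\<^esub> x = x \<otimes>\<^bsub>?Q\<^esub> z"
    define K where "K = {y \<in> carrier G. \<forall>x\<in>carrier ?Q. ?\<pi> y \<otimes>\<^bsub>?Q\<^esub> x = x \<otimes>\<^bsub>?Q\<^esub> ?\<pi> y}"
    have subK: "subgroup K G" unfolding K_def by (rule \<pi>.centre_preimage_subgroup)
    have comm: "h \<otimes> k \<otimes> inv h \<otimes> inv k \<in> M" if "h \<in> K" "k \<in> carrier G" for h k
    proof -
      have hc: "h \<in> carrier G" using that by (simp add: K_def)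
      then have "?\<pi> (h \<otimes> k \<otimes> inv h \<otimes> inv k) = M"
        using \<pi>.commutator_of_centre_preimage that oneQ unfolding K_def by blast
      moreover have "h \<otimes> k \<otimes> inv h \<otimes> inv k \<in> carrier G" using hc that(2) by simp
      ultimately show ?thesis using one by blast
    qed
    have MK: "M \<subseteq> K"
    proof
      fix y assume y: "y \<in> M"
      then have "y \<in> carrier G" "?\<pi> y = \<one>\<^bsub>?Q\<^esub>" using Mc one oneQ by auto
      then show "y \<in> K" using \<pi>.H.l_one \<pi>.H.r_one unfolding K_def by simp
    qed
    have "K \<lhd> G"
    proof (rule normal_invI[OF subK])
      fix x h assume x: "x \<in> carrier G" "h \<in> K"
      then have hc: "h \<in> carrier G" by (simp add: K_def)
      have "h \<otimes> x \<otimes> inv h \<otimes> inv x \<in> K" using comm x MK by blast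
      then have "inv (h \<otimes> x \<otimes> inv h \<otimes> inv x) \<otimes> h \<in> K"
        using subK x subgroup.m_closed subgroup.m_inv_closed by metis
      moreover have "inv (h \<otimes> x \<otimes> inv h \<otimes> inv x) \<otimes> h = x \<otimes> h \<otimes> inv x"
        using hc x by (simp add: m_assoc inv_mult_group)
      ultimately show "x \<otimes> h \<otimes> inv x \<in> K" by simp
    qed
    moreover have "\<not> lower_central_series G c \<subseteq> K" for c
    proof
      assume "lower_central_series G c \<subseteq> K"
      then have "lower_central_series G (Suc c) \<subseteq> M"
        using comm by (intro lower_central_series_SucI M.is_subgroup) blast
      then show False using M(1) by blast
    qed
    ultimately have "card K \<le> card M" using M(2) by blast
    then have "K = M" using MK fin sub subK subgroup.subset finite_subset by (metis card_seteq)
    moreover obtain y where y: "y \<in> carrier G" "z = ?\<pi> y" using z(1) surj by blast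
    then have "y \<in> K" using z(2) by (simp add: K_def)
    ultimately show "z = \<one>\<^bsub>?Q\<^esub>" using one y oneQ by simp
  qed
  moreover have "proper_subgroups_nilpotent ?Q"
    by (rule \<pi>.proper_subgroups_nilpotent_image[OF surj psn])
  ultimately show thesis using that norm by blast
qed

section \<open>Maximal subgroups and nonsimplicity\<close>

definition conj_by :: "('a, 'm) monoid_scheme \<Rightarrow> 'a \<Rightarrow> 'a \<Rightarrow> 'a" where
  "conj_by G g x = g \<otimes>\<^bsub>G\<^esub> x \<otimes>\<^bsub>G\<^esub> inv\<^bsub>G\<^esub> g"

definition set_normalizer :: "('a, 'm) monoid_scheme \<Rightarrow> 'a set \<Rightarrow> 'a set" where
  "set_normalizer G H = {g \<in> carrier G. conj_by G g ` H = H}"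

definition maximal_subgroup :: "('a, 'm) monoid_scheme \<Rightarrow> 'a set \<Rightarrow> bool" where
  "maximal_subgroup G M \<longleftrightarrow> subgroup M G \<and> M \<noteq> carrier G \<and>
     (\<forall>K. subgroup K G \<longrightarrow> M \<subseteq> K \<longrightarrow> K \<noteq> carrier G \<longrightarrow> K = M)"

section \<open>Conjugation, normalizers and maximal subgroups\<close>

context group
begin

lemma conj_by_closed [simp]: "g \<in> carrier G \<Longrightarrow> x \<in> carrier G \<Longrightarrow> conj_by G g x \<in> carrier G"
  by (simp add: conj_by_def)

lemma conj_by_m: "g \<in> carrier G \<Longrightarrow> x \<in> carrier G \<Longrightarrow> y \<in> carrier G \<Longrightarrow>
    conj_by G g (x \<otimes> y) = conj_by G g x \<otimes> conj_by G g y"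
  by (simp add: conj_by_def m_assoc inv_solve_left)

lemma conj_by_conj_by: "g \<in> carrier G \<Longrightarrow> h \<in> carrier G \<Longrightarrow> x \<in> carrier G \<Longrightarrow>
    conj_by G g (conj_by G h x) = conj_by G (g \<otimes> h) x"
  by (simp add: conj_by_def m_assoc inv_mult_group)

lemma conj_by_one_left [simp]: "x \<in> carrier G \<Longrightarrow> conj_by G \<one> x = x"
  by (simp add: conj_by_def)

lemma conj_by_one_right [simp]: "g \<in> carrier G \<Longrightarrow> conj_by G g \<one> = \<one>"
  by (simp add: conj_by_def)

lemma conj_by_inv: "g \<in> carrier G \<Longrightarrow> x \<in> carrier G \<Longrightarrow> conj_by G g (inv x) = inv (conj_by G g x)"
  by (simp add: conj_by_def m_assoc inv_mult_group)

lemma conj_by_inv_cancel: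
  "g \<in> carrier G \<Longrightarrow> x \<in> carrier G \<Longrightarrow> conj_by G (inv g) (conj_by G g x) = x"
  "g \<in> carrier G \<Longrightarrow> x \<in> carrier G \<Longrightarrow> conj_by G g (conj_by G (inv g) x) = x"
  by (simp_all add: conj_by_conj_by)

lemma conj_by_eq_iff:
  "g \<in> carrier G \<Longrightarrow> x \<in> carrier G \<Longrightarrow> conj_by G g x = x \<longleftrightarrow> g \<otimes> x = x \<otimes> g"
  unfolding conj_by_def by (metis inv_solve_right' m_closed)

lemma inj_on_conj_by: "g \<in> carrier G \<Longrightarrow> inj_on (conj_by G g) (carrier G)"
  by (metis conj_by_inv_cancel(1) inj_on_inverseI)

lemma conj_by_image_image:
  "g \<in> carrier G \<Longrightarrow> h \<in> carrier G \<Longrightarrow> H \<subseteq> carrier G \<Longrightarrow>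
    conj_by G g ` conj_by G h ` H = conj_by G (g \<otimes> h) ` H"
  by (force simp: image_image conj_by_conj_by intro!: image_cong)

lemma conj_by_image_one: "H \<subseteq> carrier G \<Longrightarrow> conj_by G \<one> ` H = H"
  by (force simp: image_def)

lemma subgroup_conj_by_image:
  assumes "g \<in> carrier G" "subgroup H G"
  shows "subgroup (conj_by G g ` H) G"
proof (rule subgroupI)
  note H = subgroup.mem_carrier[OF assms(2)]
  show "conj_by G g ` H \<subseteq> carrier G" using assms(1) H by auto
  show "conj_by G g ` H \<noteq> {}" using subgroup.one_closed[OF assms(2)] by auto
  fix a assume "a \<in> conj_by G g ` H"
  then obtain x where x: "x \<in> H" "a = conj_by G g x" by auto
  then show "inv a \<in> conj_by G g ` H"
    using assms H subgroup.m_inv_closed[OF assms(2)] conj_by_inv by (metis image_eqI)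
  fix b assume "b \<in> conj_by G g ` H"
  then obtain y where y: "y \<in> H" "b = conj_by G g y" by auto
  show "a \<otimes> b \<in> conj_by G g ` H"
    using x y assms H subgroup.m_closed[OF assms(2)] conj_by_m by (metis image_eqI)
qed

lemma card_conj_by_image:
  "g \<in> carrier G \<Longrightarrow> H \<subseteq> carrier G \<Longrightarrow> card (conj_by G g ` H) = card H"
  using inj_on_conj_by inj_on_subset card_image by blast

lemma subgroup_set_normalizer:
  assumes "H \<subseteq> carrier G"
  shows "subgroup (set_normalizer G H) G"
proof (rule subgroupI)
  show "set_normalizer G H \<subseteq> carrier G" by (auto simp: set_normalizer_def)
  show "set_normalizer G H \<noteq> {}"
    using conj_by_image_one[OF assms] by (auto simp: set_normalizer_def)
next
  fix a assume a: "a \<in> set_normalizer G H"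
  then have "conj_by G (inv a) ` conj_by G a ` H = H"
    using conj_by_image_image[of "inv a" a H] conj_by_image_one assms by (simp add: set_normalizer_def)
  then show "inv a \<in> set_normalizer G H" using a by (simp add: set_normalizer_def)
next
  fix a b assume "a \<in> set_normalizer G H" "b \<in> set_normalizer G H"
  then show "a \<otimes> b \<in> set_normalizer G H"
    using conj_by_image_image[of a b H] assms by (simp add: set_normalizer_def)
qed

lemma subgroup_subset_set_normalizer:
  assumes "subgroup H G"
  shows "H \<subseteq> set_normalizer G H"
proof
  fix g assume g: "g \<in> H"
  note H = subgroup.mem_carrier[OF assms]
  have sub: "conj_by G h ` H \<subseteq> H" if "h \<in> H" for h
    using that assms subgroup.m_closed subgroup.m_inv_closed unfolding conj_by_def
    by (metis image_subsetI)
  have "H \<subseteq> conj_by G g ` H"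
  proof
    fix x assume x: "x \<in> H"
    have "conj_by G (inv g) x \<in> H"
      using sub[of "inv g"] x g subgroup.m_inv_closed[OF assms] by auto
    then show "x \<in> conj_by G g ` H" using conj_by_inv_cancel(2)[of g x] H g x by (metis image_eqI)
  qed
  then show "g \<in> set_normalizer G H" using sub[OF g] H g by (auto simp: set_normalizer_def)
qed

text \<open>On a finite \<open>H\<close> an injective map into \<open>H\<close> is onto, so
  inclusion is enough.\<close>

lemma set_normalizerI:
  assumes "finite H" "H \<subseteq> carrier G" "g \<in> carrier G" "\<And>x. x \<in> H \<Longrightarrow> g \<otimes> x \<otimes> inv g \<in> H"
  shows "g \<in> set_normalizer G H"
proof -
  have "conj_by G g ` H \<subseteq> H" using assms(4) by (auto simp: conj_by_def)
  then have "conj_by G g ` H = H"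
    using assms card_conj_by_image by (metis card_subset_eq)
  then show ?thesis using assms(3) by (simp add: set_normalizer_def)
qed

lemma normal_if_set_normalizer_eq:
  assumes "subgroup H G" "set_normalizer G H = carrier G"
  shows "H \<lhd> G"
proof (rule normal_invI[OF assms(1)])
  fix x h assume "x \<in> carrier G" "h \<in> H"
  then have "conj_by G x h \<in> H" using assms(2) by (auto simp: set_normalizer_def)
  then show "x \<otimes> h \<otimes> inv x \<in> H" by (simp add: conj_by_def)
qed

lemma maximal_subgroup_subset: "maximal_subgroup G M \<Longrightarrow> M \<subseteq> carrier G"
  unfolding maximal_subgroup_def using subgroup.subset by auto

lemma maximal_subgroup_ex:
  assumes fin: "finite (carrier G)" and "subgroup H G" "H \<noteq> carrier G"
  obtains M where "maximal_subgroup G M" "H \<subseteq> M"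
proof -
  let ?P = "\<lambda>K. subgroup K G \<and> H \<subseteq> K \<and> K \<noteq> carrier G"
  have "\<forall>K. ?P K \<longrightarrow> card K < Suc (order G)"
    unfolding order_def less_Suc_eq_le using card_mono[OF fin] subgroup.subset by metis
  moreover have "?P H" using assms by simp
  ultimately obtain M where M: "?P M" "\<forall>K. ?P K \<longrightarrow> card K \<le> card M"
    using Lattices_Big.ex_has_greatest_nat[of ?P H card "Suc (order G)"] by metis
  have "maximal_subgroup G M"
    unfolding maximal_subgroup_def
  proof (intro conjI allI impI)
    fix K assume K: "subgroup K G" "M \<subseteq> K" "K \<noteq> carrier G"
    then have "card K \<le> card M" using M by auto
    moreover have "finite K" using K(1) fin subgroup.subset finite_subset by metis
    ultimately show "K = M" using K(2) by (metis card_seteq)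
  qed (use M in auto)
  then show thesis using that M(1) by blast
qed

lemma maximal_subgroup_conj_by:
  assumes M: "maximal_subgroup G M" and g: "g \<in> carrier G"
  shows "maximal_subgroup G (conj_by G g ` M)"
  unfolding maximal_subgroup_def
proof (intro conjI allI impI)
  have sM: "subgroup M G" and Mc: "M \<subseteq> carrier G" and Mp: "M \<noteq> carrier G"
    using M subgroup.subset unfolding maximal_subgroup_def by auto
  have undo_conj: "conj_by G (inv g) ` conj_by G g ` H = H" "conj_by G g ` conj_by G (inv g) ` H = H"
    if "H \<subseteq> carrier G" for H
    using conj_by_image_image[of "inv g" g H] conj_by_image_image[of g "inv g" H]
      conj_by_image_one[OF that] g that by simp_all
  have car: "conj_by G h ` carrier G = carrier G" if "h \<in> carrier G" for h
    using subgroup_subset_set_normalizer[OF subgroup_self] that by (auto simp: set_normalizer_def)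
  show "subgroup (conj_by G g ` M) G" using subgroup_conj_by_image g sM by blast
  show "conj_by G g ` M \<noteq> carrier G"
    using undo_conj(1)[OF Mc] car[of "inv g"] g Mp by (metis inv_closed)
  fix K assume K: "subgroup K G" "conj_by G g ` M \<subseteq> K" "K \<noteq> carrier G"
  have Kc: "K \<subseteq> carrier G" using K(1) subgroup.subset by auto
  have "M \<subseteq> conj_by G (inv g) ` K"
    using image_mono[OF K(2), of "conj_by G (inv g)"] undo_conj(1)[OF Mc] by simp
  moreover have "conj_by G (inv g) ` K \<noteq> carrier G"
    using undo_conj(2)[OF Kc] car[OF g] K(3) by metis
  moreover have "subgroup (conj_by G (inv g) ` K) G" using subgroup_conj_by_image g K(1) by simp
  ultimately have "conj_by G (inv g) ` K = M" using M unfolding maximal_subgroup_def by blast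
  then show "K = conj_by G g ` M" using undo_conj(2)[OF Kc] by simp
qed

text \<open>The pairs of \<open>g\<close> and a nontrivial \<open>m\<close> in \<open>M\<close> are
  counted by the value \<open>conj_by G g m\<close>. If two pairs share a value, the quotient of
  their first components carries a nontrivial element of \<open>M\<close> into \<open>M\<close>, and
  \<open>TI\<close> and \<open>norm\<close> place it in \<open>M\<close>. So all fibres have size
  \<open>card M\<close>, and the union has |G|(1 - 1/|M|) elements.\<close>

lemma card_union_of_conjugates:
  assumes fin: "finite (carrier G)" and M: "subgroup M G" and norm: "set_normalizer G M = M"
    and TI: "\<And>g. g \<in> carrier G \<Longrightarrow> conj_by G g ` M \<noteq> M \<Longrightarrow> conj_by G g ` M \<inter> M = {\<one>}"
  shows "card (\<Union>g\<in>carrier G. conj_by G g ` (M - {\<one>})) * card M = order G * (card M - 1)"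
proof -
  let ?A = "carrier G \<times> (M - {\<one>})" and ?f = "\<lambda>(g, m). conj_by G g m"
  let ?U = "\<Union>g\<in>carrier G. conj_by G g ` (M - {\<one>})"
  note Mc = subgroup.mem_carrier[OF M]
  have Msub: "M \<subseteq> carrier G" using Mc by auto
  have finM: "finite M" using Msub fin finite_subset by blast
  have U: "?f ` ?A = ?U" by auto
  have fibre: "card {x. x \<in> ?A \<and> ?f x = u} = card M" if u: "u \<in> ?f ` ?A" for u
  proof -
    obtain g m where gm: "g \<in> carrier G" "m \<in> M" "m \<noteq> \<one>" "u = conj_by G g m" using u by auto
    have "{x. x \<in> ?A \<and> ?f x = u} = (\<lambda>h. (g \<otimes> h, conj_by G (inv h) m)) ` M"
    proof (intro subset_antisym subsetI)
      fix x assume "x \<in> {x. x \<in> ?A \<and> ?f x = u}"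
      then obtain g' m' where x: "x = (g', m')" "g' \<in> carrier G" "m' \<in> M" "m' \<noteq> \<one>"
        "conj_by G g' m' = conj_by G g m" using gm by auto
      let ?h = "inv g \<otimes> g'"
      have hc: "?h \<in> carrier G" using gm x by simp
      have "conj_by G ?h m' = m"
        using x gm Mc conj_by_inv_cancel(1)[of g m] conj_by_conj_by[of "inv g" g' m'] by simp
      then have "m \<in> conj_by G ?h ` M \<inter> M" using x gm by auto
      then have "conj_by G ?h ` M = M" using TI[OF hc] gm(3) by blast
      then have h: "?h \<in> M" using norm hc by (auto simp: set_normalizer_def)
      have "g \<otimes> ?h = g'" using gm x by (simp add: m_assoc[symmetric])
      moreover have "conj_by G (inv ?h) m = m'"
        using \<open>conj_by G ?h m' = m\<close> conj_by_inv_cancel(1)[OF hc, of m'] Mc x by simp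
      ultimately have "x = (g \<otimes> ?h, conj_by G (inv ?h) m)" using x(1) by (simp only:)
      then show "x \<in> (\<lambda>h. (g \<otimes> h, conj_by G (inv h) m)) ` M" using h by (rule image_eqI)
    next
      fix x assume "x \<in> (\<lambda>h. (g \<otimes> h, conj_by G (inv h) m)) ` M"
      then obtain h where h: "h \<in> M" "x = (g \<otimes> h, conj_by G (inv h) m)" by auto
      have hc: "h \<in> carrier G" "m \<in> carrier G" using h gm Mc by auto
      have "inv h \<in> set_normalizer G M" using norm h subgroup.m_inv_closed[OF M] by simp
      then have "conj_by G (inv h) m \<in> M" using gm by (auto simp: set_normalizer_def)
      moreover have "conj_by G (inv h) m \<noteq> \<one>"
        using conj_by_inv_cancel(2)[OF hc] gm(3) hc(1) by auto
      moreover have "conj_by G (g \<otimes> h) (conj_by G (inv h) m) = u"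
        using gm hc by (simp add: conj_by_conj_by m_assoc)
      ultimately show "x \<in> {x. x \<in> ?A \<and> ?f x = u}" using h hc gm by simp
    qed
    moreover have "inj_on (\<lambda>h. (g \<otimes> h, conj_by G (inv h) m)) M"
      using gm Mc by (auto simp: inj_on_def)
    ultimately show ?thesis by (simp add: card_image)
  qed
  have finA: "finite ?A" using fin finM by simp
  have "card ?A = (\<Sum>u\<in>?f ` ?A. card {x. x \<in> ?A \<and> ?f x = u})"
    using sum.image_gen[OF finA, of "\<lambda>_. 1::nat" ?f] by simp
  also have "\<dots> = card ?U * card M" using fibre unfolding U by simp
  finally have "card ?U * card M = card ?A" by simp
  moreover have "card ?A = order G * (card M - 1)"
    using subgroup.one_closed[OF M] finM by (simp add: order_def card_cartesian_product card_Diff_singleton)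
  ultimately show ?thesis by simp
qed

text \<open>Take distinct maximal subgroups \<open>K\<close> and \<open>L\<close> whose intersection
  \<open>D\<close> is as large as possible. If \<open>D\<close> is nontrivial, simplicity makes its
  normalizer proper, hence contained in a maximal \<open>M\<close>. Normalizers grow in the
  nilpotent groups \<open>K\<close> and \<open>L\<close>, so \<open>M\<close> meets each of them in
  more than \<open>D\<close>; the choice of \<open>D\<close> then forces \<open>M = K\<close> and
  \<open>M = L\<close>.\<close>

lemma maximal_subgroups_TI:
  assumes fin: "finite (carrier G)" and psn: "proper_subgroups_nilpotent G"
    and simple: "\<And>N. N \<lhd> G \<Longrightarrow> N = {\<one>} \<or> N = carrier G"
    and "maximal_subgroup G M1" "maximal_subgroup G M2" "M1 \<noteq> M2"
  shows "M1 \<inter> M2 = {\<one>}"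
proof (rule ccontr)
  assume D1: "M1 \<inter> M2 \<noteq> {\<one>}"
  let ?P = "\<lambda>(K, L). maximal_subgroup G K \<and> maximal_subgroup G L \<and> K \<noteq> L"
  let ?f = "\<lambda>(K, L). card (K \<inter> L)"
  note sub = maximal_subgroup_subset
  have finm: "finite K" if "maximal_subgroup G K" for K
    using sub[OF that] fin finite_subset by blast
  have "\<forall>x. ?P x \<longrightarrow> ?f x < Suc (order G)"
  proof (intro allI impI)
    fix x assume x: "?P x"
    obtain K L where KL: "x = (K, L)" by (cases x)
    have "K \<inter> L \<subseteq> carrier G" using sub[of K] x KL by auto
    then show "?f x < Suc (order G)" using card_mono[OF fin] KL by (simp add: order_def less_Suc_eq_le)
  qed
  moreover have "?P (M1, M2)" using assms by simp
  ultimately have "\<exists>x. ?P x \<and> (\<forall>y. ?P y \<longrightarrow> ?f y \<le> ?f x)"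
    by (intro Lattices_Big.ex_has_greatest_nat[of ?P "(M1, M2)" ?f "Suc (order G)"])
  then obtain x where x: "?P x" "\<forall>y. ?P y \<longrightarrow> ?f y \<le> ?f x" by (elim exE conjE)
  obtain K L where KL: "x = (K, L)" by (cases x)
  have K: "maximal_subgroup G K" and L: "maximal_subgroup G L" and ne: "K \<noteq> L" using x KL by auto
  have best: "card (K' \<inter> L') \<le> card (K \<inter> L)"
    if "maximal_subgroup G K'" "maximal_subgroup G L'" "K' \<noteq> L'" for K' L'
    using x(2) that KL by auto
  define D where "D = K \<inter> L"
  have sK: "subgroup K G" "subgroup L G" using K L by (auto simp: maximal_subgroup_def)
  have sD: "subgroup D G" unfolding D_def using sK subgroups_Inter_pair by blast
  have Dc: "D \<subseteq> carrier G" using sD subgroup.subset by blast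
  have finD: "finite D" using Dc fin finite_subset by blast
  have "D \<noteq> {\<one>}"
  proof
    assume "D = {\<one>}"
    then have "card (M1 \<inter> M2) \<le> 1" using best[OF assms(4-6)] by (simp add: D_def)
    moreover have "{\<one>} \<subseteq> M1 \<inter> M2"
      using assms subgroup.one_closed unfolding maximal_subgroup_def by blast
    moreover have "finite (M1 \<inter> M2)" using finm assms(4) by blast
    ultimately have "{\<one>} = M1 \<inter> M2" by (intro card_seteq) auto
    then show False using D1 by simp
  qed
  have "D \<noteq> carrier G" using K sub by (auto simp: D_def maximal_subgroup_def)
  let ?N = "set_normalizer G D"
  have sN: "subgroup ?N G" by (rule subgroup_set_normalizer[OF Dc])
  have "?N \<noteq> carrier G"
    using normal_if_set_normalizer_eq[OF sD] simple \<open>D \<noteq> {\<one>}\<close> \<open>D \<noteq> carrier G\<close> by blast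
  then obtain M where M: "maximal_subgroup G M" "?N \<subseteq> M" using maximal_subgroup_ex[OF fin sN] by blast
  have key: "M = K'" if K': "maximal_subgroup G K'" "D \<subseteq> K'" "D \<noteq> K'" for K'
  proof (rule ccontr)
    assume "M \<noteq> K'"
    have sK': "subgroup K' G" "K' \<noteq> carrier G" using K'(1) by (auto simp: maximal_subgroup_def)
    interpret K': group "G\<lparr>carrier := K'\<rparr>" by (rule subgroup_imp_group[OF sK'(1)])
    have "nilpotent_group (G\<lparr>carrier := K'\<rparr>)"
      using psn sK' unfolding proper_subgroups_nilpotent_def by blast
    moreover have "subgroup D (G\<lparr>carrier := K'\<rparr>)" using subgroup_incl[OF sD sK'(1) K'(2)] .
    ultimately obtain z where z: "z \<in> K'" "z \<notin> D"
      "\<And>x. x \<in> D \<Longrightarrow> z \<otimes> x \<otimes> inv\<^bsub>G\<lparr>carrier := K'\<rparr>\<^esub> z \<in> D"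
      using K'.nilpotent_normalizer_condition[of D] K'(3) by auto
    have "inv\<^bsub>G\<lparr>carrier := K'\<rparr>\<^esub> z = inv z" using m_inv_consistent[OF sK'(1) z(1)] .
    then have "z \<in> ?N" using z sub[OF K'(1)] by (intro set_normalizerI[OF finD Dc]) auto
    then have "z \<in> M \<inter> K'" using M(2) z(1) by blast
    moreover have "D \<subseteq> M \<inter> K'" using subgroup_subset_set_normalizer[OF sD] M(2) K'(2) by blast
    ultimately have "D \<subset> M \<inter> K'" using z(2) by blast
    then have "card D < card (M \<inter> K')" using finm[OF M(1)] by (intro psubset_card_mono) auto
    moreover have "card (M \<inter> K') \<le> card D"
      using best[OF M(1) K'(1) \<open>M \<noteq> K'\<close>] by (simp add: D_def)
    ultimately show False by simp
  qed
  have "\<not> K \<subseteq> L" "\<not> L \<subseteq> K" using K L ne unfolding maximal_subgroup_def by blast+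
  then have "M = K" "M = L" using key[OF K] key[OF L] by (auto simp: D_def)
  then show False using ne by simp
qed

text \<open>If \<open>G\<close> were simple, distinct maximal subgroups would meet trivially and the
  nontrivial ones would be self-normalizing. The conjugates of one of them then contain at least
  |G|/2 elements other than 1, but not all of these. A missed element lies in a maximal subgroup
  \<open>L\<close> whose conjugates supply at least |G|/2 further ones, which is too many for the
  |G| - 1 available.\<close>

lemma nontrivial_normal_subgroup_ex:
  assumes fin: "finite (carrier G)" and nontriv: "carrier G \<noteq> {\<one>}"
    and cl: "centreless G" and psn: "proper_subgroups_nilpotent G"
  shows "\<exists>N. N \<lhd> G \<and> N \<noteq> {\<one>} \<and> N \<noteq> carrier G"
proof (rule ccontr)
  assume "\<not> ?thesis"
  then have simple: "\<And>N. N \<lhd> G \<Longrightarrow> N = {\<one>} \<or> N = carrier G" by blast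
  have TI: "M1 \<inter> M2 = {\<one>}"
    if "maximal_subgroup G M1" "maximal_subgroup G M2" "M1 \<noteq> M2" for M1 M2
    by (rule maximal_subgroups_TI[OF fin psn _ that]) (rule simple)
  have cover: "\<exists>M. maximal_subgroup G M \<and> g \<in> M" if g: "g \<in> carrier G" for g
  proof -
    have s: "subgroup (generate G {g}) G" using g by (intro generate_is_subgroup) auto
    \<comment> \<open>A cyclic group is abelian, and a nontrivial centreless group is not.\<close>
    have "generate G {g} \<noteq> carrier G"
    proof
      assume "generate G {g} = carrier G"
      then have gen: "carrier G = {g [^] (k::int) |k. k \<in> UNIV}" using generate_pow[OF g] by auto
      have comm: "z \<otimes> x = x \<otimes> z" if zx: "z \<in> carrier G" "x \<in> carrier G" for z x
      proof -
        obtain k where k: "z = g [^] (k::int)" using zx(1) gen by blast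
        obtain l where l: "x = g [^] (l::int)" using zx(2) gen by blast
        show ?thesis unfolding k l using g by (simp add: int_pow_mult[symmetric] add.commute)
      qed
      have "z = \<one>" if "z \<in> carrier G" for z
        using cl comm that unfolding centreless_def by blast
      then show False using nontriv by blast
    qed
    then obtain M where "maximal_subgroup G M" "generate G {g} \<subseteq> M" using maximal_subgroup_ex[OF fin s] by blast
    moreover have "g \<in> generate G {g}" by (simp add: generate.incl)
    ultimately show ?thesis by blast
  qed
  let ?U = "\<lambda>M. \<Union>g\<in>carrier G. conj_by G g ` (M - {\<one>})"
  have U: "card (?U M) * card M = order G * (card M - 1)" "card M \<ge> 2" "card M < order G"
    if M: "maximal_subgroup G M" "M \<noteq> {\<one>}" for M
  proof -
    have sM: "subgroup M G" and Mp: "M \<noteq> carrier G" using M by (auto simp: maximal_subgroup_def)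
    have Mc: "M \<subseteq> carrier G" using sM subgroup.subset by blast
    have finM: "finite M" using Mc fin finite_subset by blast
    have "set_normalizer G M \<noteq> carrier G"
      using normal_if_set_normalizer_eq[OF sM] simple M(2) Mp by blast
    then have "set_normalizer G M = M"
      using M(1) subgroup_set_normalizer[OF Mc] subgroup_subset_set_normalizer[OF sM]
      unfolding maximal_subgroup_def by blast
    then show "card (?U M) * card M = order G * (card M - 1)"
      by (rule card_union_of_conjugates[OF fin sM])
        (rule TI[OF maximal_subgroup_conj_by[OF M(1)] M(1)])
    show "card M < order G" unfolding order_def using fin Mc Mp by (intro psubset_card_mono) auto
    have "card M \<noteq> 0" using finM subgroup.one_closed[OF sM] by auto
    moreover have "card M \<noteq> 1" using M(2) subgroup.one_closed[OF sM] by (auto simp: card_1_singleton_iff)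
    ultimately show "card M \<ge> 2" by simp
  qed
  have Usub: "?U M \<subseteq> carrier G - {\<one>}" if "maximal_subgroup G M" for M
  proof
    fix x assume "x \<in> ?U M"
    then obtain g m where gm: "g \<in> carrier G" "m \<in> M" "m \<noteq> \<one>" "x = conj_by G g m" by auto
    have mc: "m \<in> carrier G" using maximal_subgroup_subset[OF that] gm(2) by auto
    have "x \<noteq> \<one>" using conj_by_inv_cancel(1)[OF gm(1) mc] gm by auto
    then show "x \<in> carrier G - {\<one>}" using gm mc by simp
  qed
  \<comment> \<open>The covered proportion of \<open>G\<close> is 1 - 1/|M|, and |M| is at least
    2.\<close>
  have half: "2 * card (?U M) \<ge> order G" if M: "maximal_subgroup G M" "M \<noteq> {\<one>}" for M
  proof -
    obtain m where m: "card M = m + 2" using U(2)[OF M] by (metis add.commute le_Suc_ex)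
    have e: "card (?U M) * (m + 2) = order G * (m + 1)" using U(1)[OF M] m by simp
    have "order G * (m + 2) \<le> order G * (2 * (m + 1))" by (intro mult_le_mono2) simp
    also have "\<dots> = 2 * card (?U M) * (m + 2)" using e by (simp add: algebra_simps)
    finally have "order G * (m + 2) \<le> 2 * card (?U M) * (m + 2)" .
    then show ?thesis by (rule mult_right_le_imp_le) simp
  qed
  obtain g where g: "g \<in> carrier G" "g \<noteq> \<one>" using nontriv one_closed by blast
  obtain M where M: "maximal_subgroup G M" "g \<in> M" using cover[OF g(1)] by blast
  then have M1: "M \<noteq> {\<one>}" using g by auto
  have fin1: "finite (carrier G - {\<one>})" and card1: "card (carrier G - {\<one>}) = order G - 1"
    using fin by (simp_all add: order_def card_Diff_singleton)
  have ord: "order G > 0" using fin by (simp add: order_gt_0_iff_finite)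
  \<comment> \<open>Equality would mean |G|(1 - 1/|M|) = |G| - 1, that is |M| = |G|.\<close>
  have "?U M \<noteq> carrier G - {\<one>}"
  proof
    assume "?U M = carrier G - {\<one>}"
    then have e: "(order G - 1) * card M = order G * (card M - 1)" using U(1)[OF M(1) M1] card1 by simp
    obtain a where a: "order G = a + 1" using ord by (metis Suc_eq_plus1 gr0_implies_Suc)
    obtain b where b: "card M = b + 1" using U(2)[OF M(1) M1] by (metis Suc_eq_plus1 Suc_le_D numeral_2_eq_2)
    have "a = b" using e unfolding a b by (simp add: algebra_simps)
    then show False using U(3)[OF M(1) M1] a b by simp
  qed
  then obtain h where h: "h \<in> carrier G" "h \<noteq> \<one>" "h \<notin> ?U M" using Usub[OF M(1)] by blast
  obtain L where L: "maximal_subgroup G L" "h \<in> L" using cover[OF h(1)] by blast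
  then have L1: "L \<noteq> {\<one>}" using h by auto
  \<comment> \<open>A common element makes a conjugate of \<open>M\<close> coincide with one of
    \<open>L\<close>, and then \<open>h\<close> lies in a conjugate of \<open>M\<close>.\<close>
  have "?U M \<inter> ?U L = {}"
  proof (rule ccontr)
    assume "?U M \<inter> ?U L \<noteq> {}"
    then obtain a m b l where ab: "a \<in> carrier G" "b \<in> carrier G" "m \<in> M" "l \<in> L" "m \<noteq> \<one>" "l \<noteq> \<one>"
      "conj_by G a m = conj_by G b l" by blast
    have Lc: "L \<subseteq> carrier G" and Mc: "M \<subseteq> carrier G"
      using L(1) M(1) maximal_subgroup_subset by auto
    let ?x = "conj_by G a m"
    have "?x \<in> conj_by G a ` M \<inter> conj_by G b ` L"
      using ab(3,4,7) by (intro IntI) (blast, metis image_eqI)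
    moreover have "?x \<noteq> \<one>"
    proof
      assume "?x = \<one>"
      then have "conj_by G (inv a) \<one> = m" using conj_by_inv_cancel(1)[of a m] ab Mc by auto
      then show False using ab by simp
    qed
    ultimately have "conj_by G a ` M = conj_by G b ` L"
      using TI[OF maximal_subgroup_conj_by[OF M(1) ab(1)] maximal_subgroup_conj_by[OF L(1) ab(2)]] by blast
    then have "conj_by G (inv b) ` conj_by G a ` M = conj_by G (inv b) ` conj_by G b ` L" by simp
    then have "conj_by G (inv b \<otimes> a) ` M = L"
      using ab Lc Mc conj_by_image_image[of "inv b" a M] conj_by_image_image[of "inv b" b L]
        conj_by_image_one[OF Lc] by simp
    then obtain m' where "m' \<in> M" "h = conj_by G (inv b \<otimes> a) m'" using L(2) by auto
    moreover have "m' \<noteq> \<one>" using calculation h(2) ab by auto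
    ultimately have "h \<in> ?U M" using ab by (intro UN_I[of "inv b \<otimes> a"]) auto
    then show False using h(3) by simp
  qed
  then have "card (?U M) + card (?U L) = card (?U M \<union> ?U L)"
    by (rule card_Un_disjoint[OF finite_subset[OF Usub[OF M(1)] fin1] finite_subset[OF Usub[OF L(1)] fin1], symmetric])
  also have "\<dots> \<le> order G - 1"
    using Usub[OF M(1)] Usub[OF L(1)] fin1 card1 by (metis Un_least card_mono)
  finally show False using half[OF M(1) M1] half[OF L(1) L1] ord by linarith
qed

end

section \<open>A noncentral coprime action on an elementary abelian normal subgroup\<close>

context group
begin

text \<open>Conjugation is restricted to \<open>A\<close> because the elements of
  \<open>BijGroup A\<close> are extensional on \<open>A\<close>.\<close>

lemma group_action_conj_by:
  assumes "A \<lhd> G"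
  shows "group_action G A (\<lambda>g. \<lambda>x\<in>A. conj_by G g x)"
proof -
  interpret A: normal A G by (rule assms)
  have cl: "conj_by G g x \<in> A" if "g \<in> carrier G" "x \<in> A" for g x
    unfolding conj_by_def using A.inv_op_closed2[OF that] .
  have Ac: "x \<in> carrier G" if "x \<in> A" for x using A.mem_carrier[OF that] .
  have bij: "bij_betw (conj_by G g) A A" if g: "g \<in> carrier G" for g
    by (rule bij_betwI[where g = "conj_by G (inv g)"])
      (use cl g Ac conj_by_inv_cancel in auto)
  have Bij: "(\<lambda>x\<in>A. conj_by G g x) \<in> Bij A" if "g \<in> carrier G" for g
    using bij[OF that] by (simp add: Bij_def)
  show ?thesis
    unfolding group_action_def group_hom_def group_hom_axioms_def
  proof (intro conjI is_group group_BijGroup homI)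
    fix g assume "g \<in> carrier G"
    then show "(\<lambda>x\<in>A. conj_by G g x) \<in> carrier (BijGroup A)" using Bij by (simp add: BijGroup_def)
  next
    fix g h assume gh: "g \<in> carrier G" "h \<in> carrier G"
    have "(\<lambda>x\<in>A. conj_by G (g \<otimes> h) x) = compose A (\<lambda>x\<in>A. conj_by G g x) (\<lambda>x\<in>A. conj_by G h x)"
      using gh cl Ac by (auto simp: compose_def conj_by_conj_by intro!: restrict_ext)
    then show "(\<lambda>x\<in>A. conj_by G (g \<otimes> h) x) = (\<lambda>x\<in>A. conj_by G g x) \<otimes>\<^bsub>BijGroup A\<^esub> (\<lambda>x\<in>A. conj_by G h x)"
      using Bij gh by (simp add: BijGroup_def)
  qed
qed

lemma card_subgroup_dvd:
  assumes "subgroup H G" "subgroup K G" "H \<subseteq> K"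
  shows "card H dvd card K"
  using group.lagrange[OF subgroup_imp_group[OF assms(2)] subgroup_incl[OF assms]]
  by (simp add: order_def) (metis dvd_triv_right)

text \<open>
  If all elements of prime power order prime to \<open>p\<close> centralised \<open>A\<close>, every orbit of \<open>G\<close> on \<open>A\<close>
  would have \<open>p\<close>-power length, and \<open>{1}\<close> could not be the only orbit of length 1.
\<close>

lemma noncentral_element_of_prime_power_order:
  assumes fin: "finite (carrier G)" and cl: "centreless G" and A: "A \<lhd> G"
    and p: "prime p" "p dvd card A"
  shows "\<exists>q k g a. prime q \<and> q \<noteq> p \<and> g \<in> carrier G \<and> g [^] (q ^ k :: nat) = \<one> \<and> a \<in> A \<and>
    g \<otimes> a \<noteq> a \<otimes> g"
proof (rule ccontr)
  assume "\<not> ?thesis"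
  then have comm: "g \<otimes> a = a \<otimes> g"
    if "prime q" "q \<noteq> p" "g \<in> carrier G" "g [^] (q ^ k :: nat) = \<one>" "a \<in> A" for q k g a
    using that by blast
  interpret A: normal A G by (rule A)
  let ?\<phi> = "\<lambda>g. \<lambda>x\<in>A. conj_by G g x"
  interpret act: group_action G A ?\<phi> by (rule group_action_conj_by[OF A])
  have Ac: "x \<in> carrier G" if "x \<in> A" for x using A.mem_carrier[OF that] .
  have finA: "finite A" using fin A.subset finite_subset by blast
  \<comment> \<open>A prime \<open>r\<close> other than \<open>p\<close> cannot divide the length of
    the orbit: a Sylow \<open>r\<close>-subgroup would fix \<open>a\<close>, so the index of the
    stabilizer is prime to \<open>r\<close>.\<close>
  have big: "p dvd card (orbit G ?\<phi> a)" if a: "a \<in> A" "card (orbit G ?\<phi> a) \<noteq> 1" for a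
  proof -
    obtain r where r: "prime r" "r dvd card (orbit G ?\<phi> a)" using a(2) prime_factor_nat by blast
    have "r = p"
    proof (rule ccontr)
      assume rp: "r \<noteq> p"
      let ?S = "stabilizer G ?\<phi> a"
      have oS: "card (orbit G ?\<phi> a) * card ?S = order G" by (rule act.orbit_stabilizer_theorem[OF a(1)])
      have "order G \<noteq> 0" using fin order_gt_0_iff_finite by simp
      then obtain m where m: "order G = r ^ multiplicity r (order G) * m" "\<not> r dvd m"
        using multiplicity_decompose'[of "order G" r] r(1) by (metis not_prime_unit)
      let ?k = "multiplicity r (order G)"
      obtain R where R: "subgroup R G" "card R = r ^ ?k"
        using sylow_thm[OF r(1) is_group m(1) fin] by blast
      have "R \<subseteq> ?S"
      proof
        fix g assume g: "g \<in> R"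
        then have gc: "g \<in> carrier G" using R(1) subgroup.mem_carrier by metis
        have "g [^] (r ^ ?k) = \<one>"
          using group.pow_order_eq_1[OF subgroup_imp_group[OF R(1)], of g] g R(2)
          by (simp add: order_def nat_pow_consistent[symmetric])
        then have "g \<otimes> a = a \<otimes> g" using comm[OF r(1) rp gc _ a(1)] by blast
        then have "conj_by G g a = a" using conj_by_eq_iff gc Ac a(1) by blast
        then show "g \<in> ?S" using gc a(1) by (simp add: stabilizer_def)
      qed
      then have "r ^ ?k dvd card ?S"
        using card_subgroup_dvd[OF R(1) act.stabilizer_subgroup[OF a(1)]] R(2) by simp
      then have "r * r ^ ?k dvd order G" using r(2) oS by (metis mult_dvd_mono)
      then have "r ^ ?k * r dvd r ^ ?k * m" using m(1) by (metis mult.commute)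
      then have "r dvd m" using r(1) by (simp add: prime_gt_0_nat)
      then show False using m(2) by simp
    qed
    then show ?thesis using r(2) by simp
  qed
  \<comment> \<open>An orbit of length 1 consists of a central element of \<open>G\<close>.\<close>
  have orb: "card (orbit G ?\<phi> a) \<noteq> 1" if a: "a \<in> A" "a \<noteq> \<one>" for a
  proof
    assume "card (orbit G ?\<phi> a) = 1"
    then obtain y where "orbit G ?\<phi> a = {y}" using card_1_singletonE by blast
    then have o: "orbit G ?\<phi> a = {a}" using act.orbit_refl[OF a(1)] by auto
    have "a \<otimes> g = g \<otimes> a" if g: "g \<in> carrier G" for g
    proof -
      have "?\<phi> g a \<in> orbit G ?\<phi> a" using g by (auto simp: orbit_def)
      then have "conj_by G g a = a" using o a(1) by simp
      then show ?thesis using conj_by_eq_iff g Ac a(1) by metis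
    qed
    then show False using cl Ac a unfolding centreless_def by blast
  qed
  have one: "\<one> \<in> A" by simp
  have o1: "orbit G ?\<phi> \<one> = {\<one>}"
    using one by (auto simp: orbit_def intro!: exI[of _ \<one>])
  have finO: "finite (orbits G A ?\<phi>)"
  proof -
    have "orbits G A ?\<phi> = orbit G ?\<phi> ` A" by (auto simp: orbits_def)
    then show ?thesis using finA by simp
  qed
  have "card A = (\<Sum>B\<in>orbits G A ?\<phi>. card B)"
    using act.disjoint_sum[OF finA, of "\<lambda>_. 1::nat"] by simp
  also have "\<dots> = card (orbit G ?\<phi> \<one>) + (\<Sum>B\<in>orbits G A ?\<phi> - {orbit G ?\<phi> \<one>}. card B)"
    using one by (intro sum.remove[OF finO]) (auto simp: orbits_def)
  finally have s: "card A = 1 + (\<Sum>B\<in>orbits G A ?\<phi> - {{\<one>}}. card B)" unfolding o1 by simp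
  have "p dvd (\<Sum>B\<in>orbits G A ?\<phi> - {{\<one>}}. card B)"
  proof (rule dvd_sum)
    fix B assume "B \<in> orbits G A ?\<phi> - {{\<one>}}"
    then obtain a where a: "a \<in> A" "B = orbit G ?\<phi> a" "B \<noteq> {\<one>}" by (auto simp: orbits_def)
    then have "a \<noteq> \<one>" using o1 by auto
    then show "p dvd card B" using big[OF a(1) orb[OF a(1)]] a(2) by simp
  qed
  then have "p dvd 1" using s p(2) by (metis dvd_add_left_iff)
  then show False using p(1) by simp
qed

text \<open>The elements of the centre of \<open>N\<close> with \<open>p\<close>-th power 1 form a
  characteristic subgroup of \<open>N\<close>, hence a normal subgroup of \<open>G\<close>. Choosing
  \<open>p\<close> among the prime divisors of the order of a nontrivial central element
  \<open>z\<close> makes it nontrivial.\<close>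

lemma elementary_abelian_normal_subgroup_ex:
  assumes fin: "finite (carrier G)" and N: "N \<lhd> G" "N \<noteq> {\<one>}" and nil: "nilpotent_group (G\<lparr>carrier := N\<rparr>)"
  obtains A p where "A \<lhd> G" "prime p" "p dvd card A" "\<And>x. x \<in> A \<Longrightarrow> x [^] (p::nat) = \<one>"
    "\<And>x y. x \<in> A \<Longrightarrow> y \<in> A \<Longrightarrow> x \<otimes> y = y \<otimes> x"
proof -
  interpret N: normal N G by (rule N(1))
  interpret NN: group "G\<lparr>carrier := N\<rparr>" by (rule subgroup_imp_group[OF N.is_subgroup])
  obtain z where z: "z \<in> N" "z \<noteq> \<one>" "\<And>x. x \<in> N \<Longrightarrow> z \<otimes> x = x \<otimes> z"
    using NN.nilpotent_center_nontrivial[OF nil] N(2) by auto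
  have Nc: "x \<in> carrier G" if "x \<in> N" for x using N.mem_carrier[OF that] .
  have zc: "z \<in> carrier G" using z(1) Nc by blast
  have "ord z \<noteq> 1" using ord_eq_1[OF zc] z(2) by simp
  then obtain p where p: "prime p" "p dvd ord z" using prime_factor_nat by blast
  define y where "y = z [^] (ord z div p)"
  have yc: "y \<in> carrier G" using zc by (simp add: y_def)
  have yp: "y [^] p = \<one>" using p zc by (simp add: y_def nat_pow_pow)
  have y1: "y \<noteq> \<one>"
  proof
    assume "y = \<one>"
    then have d: "ord z dvd ord z div p" using pow_eq_id[OF zc] by (simp add: y_def)
    have o: "ord z > 0" using ord_ge_1[OF fin zc] by simp
    have "ord z div p < ord z" using o prime_gt_1_nat[OF p(1)] by (rule div_less_dividend[rotated])
    moreover have "ord z div p > 0"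
      using dvd_imp_le[OF p(2) o] prime_gt_0_nat[OF p(1)] by (simp add: div_greater_zero_iff)
    ultimately show False using d nat_dvd_not_less by blast
  qed
  have yN: "y \<in> N" unfolding y_def using z(1) N.is_subgroup
    by (metis NN.nat_pow_closed nat_pow_consistent partial_object.select_convs(1) partial_object.update_convs(1) partial_object.surjective)
  have ycomm: "y \<otimes> x = x \<otimes> y" if "x \<in> N" for x
    unfolding y_def using group_commutes_pow[OF z(3)[OF that] zc Nc[OF that]] .
  define A where "A = {x \<in> N. (\<forall>w\<in>N. x \<otimes> w = w \<otimes> x) \<and> x [^] p = \<one>}"
  have comm: "x \<otimes> w = w \<otimes> x" if "x \<in> A" "w \<in> N" for x w using that unfolding A_def by blast
  have AN: "x \<in> N" and Ac: "x \<in> carrier G" and Ap: "x [^] p = \<one>" if "x \<in> A" for x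
    using that Nc unfolding A_def by auto
  have sA: "subgroup A G"
  proof (rule subgroupI)
    show "A \<subseteq> carrier G" using Ac by blast
    show "A \<noteq> {}" using yN ycomm yp unfolding A_def by blast
  next
    fix x assume x: "x \<in> A"
    have "inv x \<otimes> w = w \<otimes> inv x" if w: "w \<in> N" for w
    proof -
      have "x \<otimes> w = w \<otimes> x" by (rule comm[OF x w])
      then have "w = inv x \<otimes> (w \<otimes> x)" using Ac[OF x] Nc[OF w] by (metis inv_solve_left m_closed)
      then have "w = inv x \<otimes> w \<otimes> x" using Ac[OF x] Nc[OF w] by (simp add: m_assoc)
      then show ?thesis using Ac[OF x] Nc[OF w] by (metis inv_closed inv_solve_right m_closed)
    qed
    moreover have "inv x [^] p = \<one>" using nat_pow_inv[OF Ac[OF x], of p] Ap[OF x] by simp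
    ultimately show "inv x \<in> A" using AN[OF x] unfolding A_def by simp
  next
    fix x w assume x: "x \<in> A" and w: "w \<in> A"
    have "x \<otimes> w \<otimes> v = v \<otimes> (x \<otimes> w)" if v: "v \<in> N" for v
      using comm[OF x v] comm[OF w v] Ac[OF x] Ac[OF w] Nc[OF v] by (metis m_assoc)
    moreover have "(x \<otimes> w) [^] p = \<one>"
      using pow_mult_distrib[OF comm[OF x AN[OF w]] Ac[OF x] Ac[OF w], of p] Ap[OF x] Ap[OF w] by simp
    ultimately show "x \<otimes> w \<in> A" using AN[OF x] AN[OF w] unfolding A_def by simp
  qed
  have "A \<lhd> G"
  proof (rule normal_invI[OF sA])
    fix g x assume g: "g \<in> carrier G" and x: "x \<in> A"
    have xN: "conj_by G g x \<in> N" unfolding conj_by_def using N.inv_op_closed2[OF g AN[OF x]] .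
    have "conj_by G g x \<otimes> w = w \<otimes> conj_by G g x" if w: "w \<in> N" for w
    proof -
      have w': "conj_by G (inv g) w \<in> N" unfolding conj_by_def using N.inv_op_closed2[OF _ w, of "inv g"] g by simp
      have "conj_by G g (x \<otimes> conj_by G (inv g) w) = conj_by G g (conj_by G (inv g) w \<otimes> x)"
        using comm[OF x w'] by simp
      then show ?thesis
        using g Ac[OF x] Nc[OF w] Nc[OF w'] by (simp add: conj_by_m conj_by_inv_cancel)
    qed
    moreover have "conj_by G g x [^] p = \<one>"
    proof -
      have "conj_by G g x [^] (k::nat) = conj_by G g (x [^] k)" for k
        by (induction k) (use g Ac[OF x] in \<open>simp_all add: conj_by_m\<close>)
      then show ?thesis using g Ap[OF x] by simp
    qed
    ultimately show "g \<otimes> x \<otimes> inv g \<in> A" using xN unfolding A_def conj_by_def by blast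
  qed
  moreover have "p dvd card A"
  proof -
    have yA: "y \<in> A" using yN ycomm yp unfolding A_def by blast
    interpret AA: group "G\<lparr>carrier := A\<rparr>" by (rule subgroup_imp_group[OF sA])
    have "AA.ord y dvd p"
      using AA.pow_eq_id[of y p] yA yp by (simp add: nat_pow_consistent[symmetric])
    moreover have "AA.ord y \<noteq> 1" using AA.ord_eq_1[of y] yA y1 by simp
    ultimately have "AA.ord y = p" using p(1) prime_nat_iff by blast
    then show ?thesis using AA.ord_dvd_group_order[of y] yA by (simp add: order_def)
  qed
  ultimately show thesis using that[of A p] p(1) Ap comm AN by blast
qed

text \<open>The element found before is replaced by its last iterated \<open>q\<close>-th power that
  still fails to commute with \<open>a\<close>. Then the conjugates of \<open>a\<close> under powers
  of the new element repeat with period \<open>q\<close>.\<close>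

lemma coprime_action_ex:
  assumes fin: "finite (carrier G)" and nontriv: "carrier G \<noteq> {\<one>}"
    and cl: "centreless G" and psn: "proper_subgroups_nilpotent G"
  obtains A p q k g a where "A \<lhd> G" "prime p" "prime q" "p \<noteq> q" "\<And>x. x \<in> A \<Longrightarrow> x [^] (p::nat) = \<one>"
    "\<And>x y. x \<in> A \<Longrightarrow> y \<in> A \<Longrightarrow> x \<otimes> y = y \<otimes> x"
    "a \<in> A" "g \<in> carrier G" "g [^] (q ^ k :: nat) = \<one>" "g \<otimes> a \<noteq> a \<otimes> g"
    "g [^] q \<otimes> a = a \<otimes> g [^] q"
proof -
  obtain N where N: "N \<lhd> G" "N \<noteq> {\<one>}" "N \<noteq> carrier G"
    using nontrivial_normal_subgroup_ex[OF assms] by blast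
  have "nilpotent_group (G\<lparr>carrier := N\<rparr>)"
    using psn N normal_imp_subgroup unfolding proper_subgroups_nilpotent_def by blast
  from elementary_abelian_normal_subgroup_ex[OF fin N(1,2) this]
  obtain A p where A: "A \<lhd> G" "prime p" "p dvd card A" "\<And>x. x \<in> A \<Longrightarrow> x [^] (p::nat) = \<one>"
    "\<And>x y. x \<in> A \<Longrightarrow> y \<in> A \<Longrightarrow> x \<otimes> y = y \<otimes> x" by blast
  from noncentral_element_of_prime_power_order[OF fin cl A(1-3)]
  obtain q k g a where g: "prime q" "q \<noteq> p" "g \<in> carrier G" "g [^] (q ^ k :: nat) = \<one>" "a \<in> A"
    "g \<otimes> a \<noteq> a \<otimes> g" by blast
  have ac: "a \<in> carrier G" using g(5) A(1) normal_imp_subgroup subgroup.mem_carrier by metis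
  let ?P = "\<lambda>j. g [^] (q ^ j) \<otimes> a = a \<otimes> g [^] (q ^ j)"
  define j where "j = (LEAST j. ?P j)"
  have "?P k" using g ac by simp
  then have Pj: "?P j" unfolding j_def by (rule LeastI)
  have "\<not> ?P 0" using g by simp
  then have "j \<noteq> 0" using Pj by metis
  then obtain i where i: "j = Suc i" by (cases j) auto
  then have nP: "\<not> ?P i" using not_less_Least[of i ?P] unfolding j_def by simp
  let ?h = "g [^] (q ^ i)"
  have "?h [^] (q ^ k) = (g [^] (q ^ k)) [^] (q ^ i)" using g(3) by (simp add: nat_pow_pow mult.commute)
  then have "?h [^] (q ^ k) = \<one>" using g(4) by simp
  moreover have "?h [^] q = g [^] (q ^ j)" using g(3) i by (simp add: nat_pow_pow mult.commute)
  ultimately show thesis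
    using that[of A p q a ?h k] A g Pj nP by auto
qed

end

section \<open>Transport of algebras along injections\<close>

definition image_ualgebra :: "('b \<Rightarrow> 'c) \<Rightarrow> ('f, 'b) ualgebra \<Rightarrow> ('f, 'c) ualgebra" where
  "image_ualgebra h B =
     \<lparr>universe = h ` universe B,
      op_of = (\<lambda>F xs. h (op_of B F (map (inv_into (universe B) h) xs)))\<rparr>"

lemma eval_uterm_in_universe:
  assumes "is_ualgebra ar B" "range \<rho> \<subseteq> universe B" "wf_uterm ar t"
  shows "eval_uterm B \<rho> t \<in> universe B"
  using assms(3)
proof (induction t)
  case (Var v)
  then show ?case using assms(2) by auto
next
  case (App F ts)
  then have "set (map (eval_uterm B \<rho>) ts) \<subseteq> universe B" by (auto simp: list_all_iff)
  then show ?case using App.prems assms(1) by (auto simp: is_ualgebra_def)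
qed

lemma eval_uterm_image_ualgebra:
  assumes B: "is_ualgebra ar B" and h: "inj_on h (universe B)"
    and \<rho>: "range \<rho> \<subseteq> h ` universe B" and t: "wf_uterm ar t"
  shows "eval_uterm (image_ualgebra h B) \<rho> t
       = h (eval_uterm B (inv_into (universe B) h \<circ> \<rho>) t)"
  using t
proof (induction t)
  case (Var v)
  have "\<rho> v \<in> h ` universe B" using \<rho> by auto
  then show ?case by (simp add: f_inv_into_f)
next
  case (App F ts)
  have r: "range (inv_into (universe B) h \<circ> \<rho>) \<subseteq> universe B"
    using \<rho> by (auto intro!: inv_into_into)
  have "inv_into (universe B) h (eval_uterm (image_ualgebra h B) \<rho> t)
      = eval_uterm B (inv_into (universe B) h \<circ> \<rho>) t" if "t \<in> set ts" for t
  proof -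
    have "wf_uterm ar t" using App.prems that by (simp add: list_all_iff)
    then show ?thesis
      using App.IH[OF that] inv_into_f_f[OF h eval_uterm_in_universe[OF B r]] by metis
  qed
  then have "map (inv_into (universe B) h) (map (eval_uterm (image_ualgebra h B) \<rho>) ts)
      = map (eval_uterm B (inv_into (universe B) h \<circ> \<rho>)) ts"
    by simp
  moreover have "op_of (image_ualgebra h B) F xs = h (op_of B F (map (inv_into (universe B) h) xs))" for xs
    by (simp add: image_ualgebra_def)
  ultimately show ?case by (simp only: eval_uterm.simps)
qed

lemma is_ualgebra_image:
  assumes "is_ualgebra ar B"
  shows "is_ualgebra ar (image_ualgebra h B)"
  unfolding is_ualgebra_def
proof (intro conjI allI impI)
  show "universe (image_ualgebra h B) \<noteq> {}"
    using assms by (auto simp: is_ualgebra_def image_ualgebra_def)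
next
  fix F xs
  assume xs: "length xs = ar F \<and> set xs \<subseteq> universe (image_ualgebra h B)"
  then have "set (map (inv_into (universe B) h) xs) \<subseteq> universe B"
    by (auto simp: image_ualgebra_def intro!: inv_into_into)
  then show "op_of (image_ualgebra h B) F xs \<in> universe (image_ualgebra h B)"
    using xs assms unfolding image_ualgebra_def is_ualgebra_def by simp
qed

lemma in_variety_upto_image:
  assumes "in_variety_upto ar n A B" "inj_on h (universe B)"
  shows "in_variety_upto ar n A (image_ualgebra h B)"
proof -
  have B: "is_ualgebra ar B" using assms(1) by (simp add: in_variety_upto_def)
  have "satisfies_identity (image_ualgebra h B) s t"
    if st: "satisfies_identity B s t" "wf_uterm ar s" "wf_uterm ar t"
    for s t :: "('a, nat) uterm"
    unfolding satisfies_identity_def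
  proof (intro allI impI)
    fix \<rho> :: "nat \<Rightarrow> 'd" assume \<rho>: "range \<rho> \<subseteq> universe (image_ualgebra h B)"
    then have \<rho>: "range \<rho> \<subseteq> h ` universe B" by (simp add: image_ualgebra_def)
    then have "range (inv_into (universe B) h \<circ> \<rho>) \<subseteq> universe B"
      by (auto intro!: inv_into_into)
    then show "eval_uterm (image_ualgebra h B) \<rho> s = eval_uterm (image_ualgebra h B) \<rho> t"
      using st by (simp add: eval_uterm_image_ualgebra[OF B assms(2) \<rho>] satisfies_identity_def)
  qed
  then show ?thesis
    using assms(1) is_ualgebra_image[OF B] unfolding in_variety_upto_def by blast
qed

lemma generated_by_at_most_image:
  assumes B: "is_ualgebra ar B" and h: "inj_on h (universe B)"
    and "generated_by_at_most ar B d"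
  shows "generated_by_at_most ar (image_ualgebra h B) d"
proof -
  let ?B = "image_ualgebra h B"
  obtain X where X: "X \<subseteq> universe B" "finite X" "card X \<le> d"
    "subuniverse_generated ar B X = universe B"
    using assms(3) unfolding generated_by_at_most_def by blast
  have U: "universe ?B = h ` universe B" by (simp add: image_ualgebra_def)
  have "x \<in> universe ?B" if "x \<in> subuniverse_generated ar ?B (h ` X)" for x
    using that
  proof induction
    case (gen x)
    then show ?case using X U by auto
  next
    case (app xs F)
    then show ?case using is_ualgebra_image[OF B, of h] by (auto simp: is_ualgebra_def)
  qed
  moreover have "h x \<in> subuniverse_generated ar ?B (h ` X)"
    if "x \<in> subuniverse_generated ar B X" for x
    using that
  proof induction
    case (gen x)
    then show ?case by (auto intro: subuniverse_generated.gen)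
  next
    case (app xs F)
    have "op_of ?B F (map h xs) \<in> subuniverse_generated ar ?B (h ` X)"
      using app by (intro subuniverse_generated.app) auto
    moreover have "map (inv_into (universe B) h) (map h xs) = xs"
      using app X h by (auto intro!: map_idI)
    ultimately show ?case by (simp add: image_ualgebra_def)
  qed
  ultimately have "subuniverse_generated ar ?B (h ` X) = universe ?B"
    using X U by auto
  moreover have "card (h ` X) \<le> d" using X card_image_le le_trans by blast
  ultimately show ?thesis
    unfolding generated_by_at_most_def using X U
    by (intro exI[of _ "h ` X"]) auto
qed

text \<open>Witnesses may live over any type \<open>'b\<close>: a finite universe injects into the
  natural numbers, and the algebra is transported along the injection.\<close>

lemma inherently_nonfinitely_based_in_finite_senseI:
  fixes A :: "('f, 'a) ualgebra"
  assumes "\<And>n. n \<ge> 1 \<Longrightarrow> \<exists>d\<ge>1. \<forall>l>0. \<exists>B :: ('f, 'b) ualgebra.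
      in_variety_upto ar n A B \<and> finite (universe B) \<and>
      generated_by_at_most ar B d \<and> l \<le> card (universe B)"
  shows "inherently_nonfinitely_based_in_finite_sense ar A"
  unfolding inherently_nonfinitely_based_in_finite_sense_def
proof (intro allI impI)
  fix n :: nat assume "1 \<le> n"
  then obtain d where d: "d \<ge> 1" "\<forall>l>0. \<exists>B :: ('f, 'b) ualgebra.
      in_variety_upto ar n A B \<and> finite (universe B) \<and>
      generated_by_at_most ar B d \<and> l \<le> card (universe B)"
    using assms[of n] by blast
  have "\<exists>B :: ('f, nat) ualgebra.
      in_variety_upto ar n A B \<and> finite (universe B) \<and>
      generated_by_at_most ar B d \<and> l \<le> card (universe B)" if l: "l > 0" for l
  proof -
    obtain B :: "('f, 'b) ualgebra" where B: "in_variety_upto ar n A B" "finite (universe B)"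
      "generated_by_at_most ar B d" "l \<le> card (universe B)"
      using d(2) l by blast
    obtain h :: "'b \<Rightarrow> nat" where h: "inj_on h (universe B)"
      using finite_imp_inj_to_nat_seg[OF B(2)] by blast
    have "is_ualgebra ar B" using B(1) by (simp add: in_variety_upto_def)
    moreover have "finite (universe (image_ualgebra h B))" "l \<le> card (universe (image_ualgebra h B))"
      using B h by (simp_all add: image_ualgebra_def card_image)
    ultimately show ?thesis
      using in_variety_upto_image[OF B(1) h] generated_by_at_most_image[OF _ h B(3)] by blast
  qed
  then show "\<exists>d\<ge>1. \<forall>l>0. \<exists>B :: ('f, nat) ualgebra.
      in_variety_upto ar n A B \<and> finite (universe B) \<and>
      generated_by_at_most ar B d \<and> l \<le> card (universe B)"
    using d(1) by blast
qed

section \<open>Algebras of an action\<close>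

text \<open>Common form of the algebra of the theorem and of the witnesses, so that one evaluation
  formula serves both.\<close>

definition pair_algebra :: "'p set \<Rightarrow> 'q set \<Rightarrow> ('p \<Rightarrow> 'q \<Rightarrow> 'q) \<Rightarrow> (fd_symbol, 'p \<times> 'q) ualgebra" where
  "pair_algebra P Q act =
     \<lparr>universe = P \<times> Q,
      op_of = (\<lambda>F xs. case F of
         Sym_f \<Rightarrow> (fst (xs ! 0), act (fst (xs ! 0)) (snd (xs ! 0)))
       | Sym_d \<Rightarrow> (fst (xs ! 0), snd (xs ! 1)))\<rparr>"

lemma action_algebra_eq_pair_algebra:
  "action_algebra G S \<alpha> = pair_algebra (with_zero (carrier G)) (with_zero S) (action_zero \<alpha>)"
  unfolding action_algebra_def pair_algebra_def action_f_def action_d_def by simp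

text \<open>
  Modulo the identities of rectangular bands, every term has the normal form
  \<open>d(h, f(d(v\<^sub>1, f(d(v\<^sub>2, \<dots> z)))))\<close> with variables \<open>h\<close>, \<open>v\<^sub>i\<close>, \<open>z\<close>; these are its head,
  its word and its tail.
\<close>

fun term_head :: "(fd_symbol, 'v) uterm \<Rightarrow> 'v" where
  "term_head (Var v) = v"
| "term_head (App Sym_f [t]) = term_head t"
| "term_head (App Sym_d [s, t]) = term_head s"

fun term_tail :: "(fd_symbol, 'v) uterm \<Rightarrow> 'v" where
  "term_tail (Var v) = v"
| "term_tail (App Sym_f [t]) = term_tail t"
| "term_tail (App Sym_d [s, t]) = term_tail t"

fun term_word :: "(fd_symbol, 'v) uterm \<Rightarrow> 'v list" where
  "term_word (Var v) = []"
| "term_word (App Sym_f [t]) = term_head t # term_word t"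
| "term_word (App Sym_d [s, t]) = term_word t"

text \<open>The three cases are the shapes on which \<open>term_head\<close>,
  \<open>term_tail\<close> and \<open>term_word\<close> have equations.\<close>

lemma wf_fd_term_induct [consumes 1, case_names Var f d]:
  assumes "wf_uterm fd_arity t"
    and "\<And>v. P (Var v)"
    and "\<And>t. wf_uterm fd_arity t \<Longrightarrow> P t \<Longrightarrow> P (App Sym_f [t])"
    and "\<And>s t. wf_uterm fd_arity s \<Longrightarrow> wf_uterm fd_arity t \<Longrightarrow> P s \<Longrightarrow> P t \<Longrightarrow> P (App Sym_d [s, t])"
  shows "P t"
  using assms(1)
proof (induction t)
  case (Var v)
  show ?case by (rule assms(2))
next
  case (App F ts)
  show ?case
  proof (cases F)
    case Sym_f
    with App.prems obtain t where "ts = [t]" by (auto simp: length_Suc_conv)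
    then show ?thesis using App Sym_f assms(3) by simp
  next
    case Sym_d
    with App.prems obtain s t where "ts = [s, t]" by (auto simp: length_Suc_conv numeral_2_eq_2)
    then show ?thesis using App Sym_d assms(4) by simp
  qed
qed

lemma term_vars_subset:
  assumes "wf_uterm fd_arity t"
  shows "term_head t \<in> uterm_vars t" "term_tail t \<in> uterm_vars t" "set (term_word t) \<subseteq> uterm_vars t"
  using assms by (induction rule: wf_fd_term_induct) auto

text \<open>Since \<open>f\<close> keeps the first component, what acts at each \<open>f\<close> is
  the value of the head of its argument.\<close>

lemma eval_pair_algebra:
  assumes "wf_uterm fd_arity t"
  shows "eval_uterm (pair_algebra P Q act) \<rho> t =
    (fst (\<rho> (term_head t)),
     foldr (\<lambda>v. act (fst (\<rho> v))) (term_word t) (snd (\<rho> (term_tail t))))"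
  using assms by (induction rule: wf_fd_term_induct) (auto simp: pair_algebra_def)

lemma is_ualgebra_pair_algebra:
  assumes "P \<noteq> {}" "Q \<noteq> {}" "\<And>p q. p \<in> P \<Longrightarrow> q \<in> Q \<Longrightarrow> act p q \<in> Q"
  shows "is_ualgebra fd_arity (pair_algebra P Q act)"
  unfolding is_ualgebra_def
proof (intro conjI allI impI)
  show "universe (pair_algebra P Q act) \<noteq> {}" using assms by (auto simp: pair_algebra_def)
next
  fix F xs
  assume h: "length xs = fd_arity F \<and> set xs \<subseteq> universe (pair_algebra P Q act)"
  show "op_of (pair_algebra P Q act) F xs \<in> universe (pair_algebra P Q act)"
  proof (cases F)
    case Sym_f
    then obtain x where "xs = [x]" using h by (auto simp: length_Suc_conv)
    then show ?thesis using h Sym_f assms(3) by (auto simp: pair_algebra_def)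
  next
    case Sym_d
    then obtain x y where "xs = [x, y]" using h by (auto simp: length_Suc_conv numeral_2_eq_2)
    then show ?thesis using h Sym_d by (auto simp: pair_algebra_def)
  qed
qed

text \<open>\<open>P \<times> {q0}\<close> generates. If \<open>r\<close> occurs as a second
  component, then \<open>d\<close> yields \<open>(p, r)\<close> for every \<open>p\<close> in
  \<open>P\<close>, and \<open>f\<close> yields \<open>(p, act p r)\<close>. So the second
  components that occur are closed under the action; \<open>reach\<close> is reachability from
  \<open>q0\<close> in the form of an induction principle.\<close>

lemma generated_pair_algebra:
  assumes P: "finite P" "P \<noteq> {}" "card P \<le> d" and cl: "\<And>p q. p \<in> P \<Longrightarrow> q \<in> Q \<Longrightarrow> act p q \<in> Q"
    and q0: "q0 \<in> Q"
    and reach: "\<And>R q. q0 \<in> R \<Longrightarrow> (\<And>p r. p \<in> P \<Longrightarrow> r \<in> R \<Longrightarrow> act p r \<in> R) \<Longrightarrow> q \<in> Q \<Longrightarrow> q \<in> R"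
  shows "generated_by_at_most fd_arity (pair_algebra P Q act) d"
proof -
  let ?A = "pair_algebra P Q act"
  let ?X = "P \<times> {q0}"
  let ?gen = "subuniverse_generated fd_arity ?A ?X"
  have f: "(p, act p q) \<in> ?gen" if "(p, q) \<in> ?gen" for p q
    using subuniverse_generated.app[of "[(p, q)]" fd_arity Sym_f ?A ?X] that
    by (simp add: pair_algebra_def)
  have d: "(p, q') \<in> ?gen" if "(p, q) \<in> ?gen" "(p', q') \<in> ?gen" for p q p' q'
    using subuniverse_generated.app[of "[(p, q), (p', q')]" fd_arity Sym_d ?A ?X] that
    by (simp add: pair_algebra_def)
  have X: "(p, q0) \<in> ?gen" if "p \<in> P" for p
    using that by (auto intro: subuniverse_generated.gen)
  let ?R = "{q. \<exists>p\<in>P. (p, q) \<in> ?gen}"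
  have "q \<in> ?R" if "q \<in> Q" for q
  proof (rule reach[OF _ _ that])
    show "q0 \<in> ?R" using P X by auto
    show "act p r \<in> ?R" if "p \<in> P" "r \<in> ?R" for p r
      using that f[OF d[OF X[OF that(1)]]] by blast
  qed
  then have 1: "P \<times> Q \<subseteq> ?gen" using d X by blast
  have 2: "?gen \<subseteq> P \<times> Q"
  proof
    fix x assume "x \<in> ?gen"
    then show "x \<in> P \<times> Q"
    proof induction
      case (gen x)
      then show ?case using q0 by auto
    next
      case (app xs F)
      have "is_ualgebra fd_arity ?A"
        using is_ualgebra_pair_algebra[of P Q act] P q0 cl by blast
      then show ?case using app unfolding is_ualgebra_def by (auto simp: pair_algebra_def)
    qed
  qed
  have "card ?X \<le> d" using P by (simp add: card_cartesian_product)
  then show ?thesis unfolding generated_by_at_most_def using 1 2 P q0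
    by (intro exI[of _ ?X]) (auto simp: pair_algebra_def)
qed

section \<open>A large action with locally tame words\<close>

datatype letter = X | Y | Z nat

text \<open>Words act from the right, as in \<open>foldr\<close>. The tail behind an occurrence of
  \<open>l\<close> is what was applied before it, so \<open>\<Phi>\<close> is a condition on the
  state in which that occurrence acts.\<close>

fun hits :: "'l \<Rightarrow> ('l list \<Rightarrow> bool) \<Rightarrow> 'l list \<Rightarrow> nat" where
  "hits l \<Phi> [] = 0"
| "hits l \<Phi> (a # w) = (if a = l \<and> \<Phi> w then 1 else 0) + hits l \<Phi> w"

lemma hits_eq_0: "l \<notin> set w \<Longrightarrow> hits l \<Phi> w = 0"
  by (induction w) auto

lemma hits_False: "(\<And>w'. set w' \<subseteq> set w \<Longrightarrow> \<not> \<Phi> w') \<Longrightarrow> hits l \<Phi> w = 0"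
proof (induction w)
  case (Cons a w)
  have "\<not> \<Phi> w" by (rule Cons.prems) auto
  moreover have "hits l \<Phi> w = 0" by (rule Cons.IH, rule Cons.prems) auto
  ultimately show ?case by simp
qed simp

definition letters :: "nat \<Rightarrow> letter set" where
  "letters n = {X, Y} \<union> Z ` {..<n}"

lemma card_letters: "card (letters n) = n + 2"
proof -
  have "card (Z ` {..<n}) = n" by (simp add: card_image inj_on_def)
  then show ?thesis unfolding letters_def by (subst card_Un_disjoint) auto
qed

text \<open>\<open>s\<close> and \<open>t\<close> stand for the two generators of \<open>D\<close>
  acting on \<open>{..<N}\<close>. The assumption \<open>step\<close> is the source of reachability,
  and \<open>q \<ge> 2\<close> keeps the residues 0 and 1 apart.\<close>

locale letter_action =
  fixes n q p N :: nat and s t :: "nat \<Rightarrow> nat"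
  assumes q: "q \<ge> 2"
    and s_less: "k < N \<Longrightarrow> s k < N" and t_less: "k < N \<Longrightarrow> t k < N"
    and s_pow: "k < N \<Longrightarrow> (s ^^ p) k = k" and t_pow: "k < N \<Longrightarrow> (t ^^ p) k = k"
    and step: "Suc k < N \<Longrightarrow> s k = Suc k \<or> t k = Suc k" and N: "N > 0"
begin

definition states :: "(nat \<times> (nat \<Rightarrow> nat)) set" where
  "states = {..<N} \<times> ({..<n} \<rightarrow>\<^sub>E {..<q})"

text \<open>The imprimitive action of the wreath product: \<open>u\<close> names the copy of
  \<open>{..<N}\<close> containing the point \<open>k\<close>. \<open>X\<close> is \<open>s\<close>
  on the copy (0,...,0) only, \<open>Y\<close> is \<open>t\<close> on the copy (1,...,1) only, and
  the \<open>Z i\<close> permute the copies.\<close>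

fun act :: "letter \<Rightarrow> nat \<times> (nat \<Rightarrow> nat) \<Rightarrow> nat \<times> (nat \<Rightarrow> nat)" where
  "act X (k, u) = (if \<forall>i<n. u i = 0 then s k else k, u)"
| "act Y (k, u) = (if \<forall>i<n. u i = 1 then t k else k, u)"
| "act (Z i) (k, u) = (k, u(i := (u i + 1) mod q))"

lemma act_states: "l \<in> letters n \<Longrightarrow> r \<in> states \<Longrightarrow> act l r \<in> states"
  using q s_less t_less
  by (cases r; cases l) (auto simp: states_def letters_def PiE_iff extensional_def)

lemma foldr_act_states: "set w \<subseteq> letters n \<Longrightarrow> r \<in> states \<Longrightarrow> foldr act w r \<in> states"
  by (induction w) (auto intro: act_states)

lemma snd_foldr_act:
  assumes "set w \<subseteq> letters n" "(k, u) \<in> states" "i < n"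
  shows "snd (foldr act w (k, u)) i = (u i + count_list w (Z i)) mod q"
  using assms(1)
proof (induction w)
  case Nil
  then show ?case using assms by (auto simp: states_def PiE_iff)
next
  case (Cons l w)
  obtain k' u' where r: "foldr act w (k, u) = (k', u')" by (cases "foldr act w (k, u)")
  then show ?case using Cons by (cases l) (auto simp: mod_simps)
qed

text \<open>How often \<open>l\<close> meets the copy (c,...,c) when the word starts in the copy
  \<open>u\<close>. With \<open>c = 0\<close> for \<open>X\<close> and \<open>c = 1\<close> for
  \<open>Y\<close> these are the applications of \<open>s\<close> and \<open>t\<close>.\<close>

definition hits_at :: "letter \<Rightarrow> nat \<Rightarrow> (nat \<Rightarrow> nat) \<Rightarrow> letter list \<Rightarrow> nat" where
  "hits_at l c u = hits l (\<lambda>w. \<forall>i<n. (u i + count_list w (Z i)) mod q = c)"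

text \<open>If one of \<open>s\<close> and \<open>t\<close> is never applied, their failure to
  commute cannot show, and the first component depends on a count only.\<close>

lemma fst_foldr_act:
  assumes "set w \<subseteq> letters n" "(k, u) \<in> states"
  shows "hits_at Y 1 u w = 0 \<Longrightarrow> fst (foldr act w (k, u)) = (s ^^ hits_at X 0 u w) k"
    and "hits_at X 0 u w = 0 \<Longrightarrow> fst (foldr act w (k, u)) = (t ^^ hits_at Y 1 u w) k"
proof -
  have "(hits_at Y 1 u w = 0 \<longrightarrow> fst (foldr act w (k, u)) = (s ^^ hits_at X 0 u w) k) \<and>
    (hits_at X 0 u w = 0 \<longrightarrow> fst (foldr act w (k, u)) = (t ^^ hits_at Y 1 u w) k)"
    using assms(1)
  proof (induction w)
    case Nil
    then show ?case by (simp add: hits_at_def)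
  next
    case (Cons l w)
    obtain k' u' where r: "foldr act w (k, u) = (k', u')" by (cases "foldr act w (k, u)")
    have u': "\<forall>i<n. u' i = (u i + count_list w (Z i)) mod q"
      using snd_foldr_act[of w k u] r Cons.prems assms by auto
    then show ?case using Cons r by (cases l) (auto simp: hits_at_def)
  qed
  then show "hits_at Y 1 u w = 0 \<Longrightarrow> fst (foldr act w (k, u)) = (s ^^ hits_at X 0 u w) k"
    and "hits_at X 0 u w = 0 \<Longrightarrow> fst (foldr act w (k, u)) = (t ^^ hits_at Y 1 u w) k"
    by auto
qed

lemma funpow_less_N: "k < N \<Longrightarrow> (s ^^ m) k < N" "k < N \<Longrightarrow> (t ^^ m) k < N"
  by (induction m) (auto simp: s_less t_less)

lemma funpow_cong:
  assumes f: "\<And>k m. k < N \<Longrightarrow> (f ^^ m) k < N" "\<And>k. k < N \<Longrightarrow> (f ^^ p) k = k"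
    and "[a = b] (mod p)" and k: "(k::nat) < N"
  shows "(f ^^ a) k = (f ^^ b) k"
proof -
  have m: "(f ^^ (p * m)) k = k" for m
    by (induction m) (auto simp: funpow_add f k)
  have "(f ^^ a) k = (f ^^ (a mod p)) k" for a
  proof -
    have "(f ^^ a) k = (f ^^ (a mod p + p * (a div p))) k" by simp
    also have "\<dots> = (f ^^ (a mod p)) k" by (simp only: funpow_add o_apply m)
    finally show ?thesis .
  qed
  then show ?thesis using assms(3) unfolding cong_def by metis
qed

text \<open>
  Some letter is missing from both words. If it is \<open>X\<close> or \<open>Y\<close>, only one of the permutations
  \<open>s\<close> and \<open>t\<close> is ever applied. If it is \<open>Z i\<close>, the coordinate \<open>u i\<close> never changes, and since \<open>X\<close>
  needs \<open>u i = 0\<close> and \<open>Y\<close> needs \<open>u i = 1\<close>, again only one of them is applied.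
\<close>

lemma foldr_act_eq:
  assumes w: "set w \<subseteq> L" "set w' \<subseteq> L" and L: "L \<subset> letters n"
    and r: "r \<in> states"
    and cnt: "\<And>i. i < n \<Longrightarrow> [count_list w (Z i) = count_list w' (Z i)] (mod q)"
    and hits: "\<And>l c. l = X \<or> l = Y \<Longrightarrow>
      [hits l (\<lambda>v. \<forall>i<n. [count_list v (Z i) = c i] (mod q)) w =
       hits l (\<lambda>v. \<forall>i<n. [count_list v (Z i) = c i] (mod q)) w'] (mod p)"
  shows "foldr act w r = foldr act w' r"
proof -
  obtain k u where ku: "r = (k, u)" by (cases r)
  have k: "k < N" using r ku by (auto simp: states_def)
  have u: "u i < q" if "i < n" for i using r ku that by (auto simp: states_def PiE_iff)
  have wl: "set w \<subseteq> letters n" "set w' \<subseteq> letters n" using w L by auto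
  \<comment> \<open>Turns a condition on the current copy into one on the counts alone;
    \<open>q - u i\<close> represents minus \<open>u i\<close> modulo \<open>q\<close>.\<close>
  have shift: "((u i + m) mod q = c) = [m = q - u i + c] (mod q)" if "i < n" "c < q" for i m c
  proof -
    have "((u i + m) mod q = c) \<longleftrightarrow> [u i + m = u i + (q - u i + c)] (mod q)"
      using u[OF that(1)] that(2) by (simp add: cong_def)
    then show ?thesis by (simp add: cong_add_lcancel_nat)
  qed
  have at: "hits_at l c u v =
      hits l (\<lambda>v. \<forall>i<n. [count_list v (Z i) = q - u i + c] (mod q)) v" if "c < q" for l c v
    unfolding hits_at_def using shift[OF _ that] by metis
  have cong: "[hits_at l c u w = hits_at l c u w'] (mod p)" if "c < q" "l = X \<or> l = Y" for l c
    unfolding at[OF that(1)] using hits[OF that(2), of "\<lambda>i. q - u i + c"] .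
  obtain m where m: "m \<in> letters n" "m \<notin> L" using L by auto
  have "(hits_at X 0 u w = 0 \<and> hits_at X 0 u w' = 0) \<or> (hits_at Y 1 u w = 0 \<and> hits_at Y 1 u w' = 0)"
  proof (cases m)
    case X
    then show ?thesis using m w by (auto simp: hits_at_def intro!: hits_eq_0)
  next
    case Y
    then show ?thesis using m w by (auto simp: hits_at_def intro!: hits_eq_0)
  next
    case (Z i)
    then have i: "i < n" using m by (auto simp: letters_def)
    have 0: "hits_at l c u v = 0" if "set v \<subseteq> L" "u i \<noteq> c" for l c v
      unfolding hits_at_def
    proof (rule hits_False)
      fix v' assume "set v' \<subseteq> set v"
      then have "count_list v' (Z i) = 0" using that m Z by (auto simp: count_list_0_iff)
      then show "\<not> (\<forall>i<n. (u i + count_list v' (Z i)) mod q = c)"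
        using i u[OF i] that(2) by auto
    qed
    then show ?thesis using w by (metis zero_neq_one)
  qed
  then have "fst (foldr act w r) = fst (foldr act w' r)"
  proof
    assume h: "hits_at X 0 u w = 0 \<and> hits_at X 0 u w' = 0"
    show ?thesis
      using h fst_foldr_act(2)[OF wl(1), of k u] fst_foldr_act(2)[OF wl(2), of k u] r ku
        funpow_cong[OF funpow_less_N(2) t_pow cong[of 1 Y], of k] q k by auto
  next
    assume h: "hits_at Y 1 u w = 0 \<and> hits_at Y 1 u w' = 0"
    show ?thesis
      using h fst_foldr_act(1)[OF wl(1), of k u] fst_foldr_act(1)[OF wl(2), of k u] r ku
        funpow_cong[OF funpow_less_N(1) s_pow cong[of 0 X], of k] q k by auto
  qed
  moreover have "snd (foldr act w r) = snd (foldr act w' r)"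
  proof (rule extensionalityI)
    show "snd (foldr act w r) \<in> extensional {..<n}" "snd (foldr act w' r) \<in> extensional {..<n}"
      using foldr_act_states[OF wl(1) r] foldr_act_states[OF wl(2) r]
      by (auto simp: states_def PiE_iff mem_Times_iff)
    fix i assume "i \<in> {..<n}"
    then have i: "i < n" by simp
    have "[u i + count_list w (Z i) = u i + count_list w' (Z i)] (mod q)"
      using cnt[OF i] by (intro cong_add) auto
    then show "snd (foldr act w r) i = snd (foldr act w' r) i"
      using snd_foldr_act[OF wl(1) _ i, of k u] snd_foldr_act[OF wl(2) _ i, of k u] r ku
      by (simp add: cong_def)
  qed
  ultimately show ?thesis by (simp add: prod_eq_iff)
qed

lemma finite_states: "finite states"
  unfolding states_def by (intro finite_cartesian_product finite_PiE) auto

lemma N_le_card_states: "N \<le> card states"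
proof -
  have "card ({..<n} \<rightarrow>\<^sub>E {..<q}) > 0"
    using q by (simp add: card_PiE)
  then show ?thesis by (simp add: states_def card_cartesian_product)
qed

text \<open>For fixed \<open>k\<close> the \<open>Z i\<close> lead from any copy to any other. So
  \<open>k\<close> can be raised by 1 through \<open>X\<close> in the copy (0,...,0) or through
  \<open>Y\<close> in the copy (1,...,1), whichever \<open>step\<close> provides.\<close>

lemma states_reachable:
  assumes R0: "(0, \<lambda>i\<in>{..<n}. 0) \<in> R"
    and R: "\<And>l r. l \<in> letters n \<Longrightarrow> r \<in> R \<Longrightarrow> act l r \<in> R"
    and r: "r \<in> states"
  shows "r \<in> R"
proof -
  have XY: "X \<in> letters n" "Y \<in> letters n" and Z: "\<And>i. i < n \<Longrightarrow> Z i \<in> letters n"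
    by (auto simp: letters_def)
  let ?F = "{..<n} \<rightarrow>\<^sub>E {..<q}"
  have add: "(k, u(i := (u i + m) mod q)) \<in> R" if "(k, u) \<in> R" "i < n" "u i < q" for k u i m
  proof (induction m)
    case 0
    then show ?case using that by simp
  next
    case (Suc m)
    have "u(i := (u i + m) mod q, i := ((u i + m) mod q + 1) mod q) = u(i := (u i + Suc m) mod q)"
      by (simp add: mod_simps)
    then show ?case
      using R[OF Z[OF that(2)] Suc] by (simp only: act.simps fun_upd_same)
  qed
  \<comment> \<open>The number of applications of \<open>Z i\<close> represents \<open>v\<close>
    minus \<open>u i\<close> modulo \<open>q\<close>.\<close>
  have upd: "(k, u(i := v)) \<in> R" if "(k, u) \<in> R" "i < n" "u i < q" "v < q" for k u i v
    using add[OF that(1-3), of "v + q - u i"] that(3,4) by simp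
  have move: "(k, u') \<in> R" if ku: "(k, u) \<in> R" and u: "u \<in> ?F" "u' \<in> ?F" for k u u'
  proof -
    have "(k, \<lambda>i. if i < j then u' i else u i) \<in> R" if "j \<le> n" for j
      using that
    proof (induction j)
      case 0
      then show ?case using ku by simp
    next
      case (Suc j)
      have "(k, (\<lambda>i. if i < j then u' i else u i)(j := u' j)) \<in> R"
        using Suc u by (intro upd) (auto simp: PiE_iff)
      moreover have "(\<lambda>i. if i < j then u' i else u i)(j := u' j)
          = (\<lambda>i. if i < Suc j then u' i else u i)"
        by (auto simp: less_Suc_eq)
      ultimately show ?case by simp
    qed
    from this[of n] have "(k, \<lambda>i. if i < n then u' i else u i) \<in> R" by simp
    moreover have "(\<lambda>i. if i < n then u' i else u i) = u'"
      using u by (auto simp: PiE_iff extensional_def)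
    ultimately show ?thesis by simp
  qed
  have F: "(\<lambda>i\<in>{..<n}. c) \<in> ?F" if "c < q" for c using that by auto
  have "(k, \<lambda>i\<in>{..<n}. 0) \<in> R" if "k < N" for k
    using that
  proof (induction k)
    case 0
    show ?case by (rule R0)
  next
    case (Suc k)
    then have k: "(k, \<lambda>i\<in>{..<n}. 0) \<in> R" using Suc_lessD by blast
    from step[OF Suc.prems] show ?case
    proof
      assume "s k = Suc k"
      moreover have "act X (k, \<lambda>i\<in>{..<n}. 0) = (s k, \<lambda>i\<in>{..<n}. 0)" by simp
      ultimately show ?thesis using R[OF XY(1) k] by metis
    next
      assume t: "t k = Suc k"
      have "(k, \<lambda>i\<in>{..<n}. 1) \<in> R" by (rule move[OF k F F]) (use q in auto)
      moreover have "act Y (k, \<lambda>i\<in>{..<n}. 1) = (t k, \<lambda>i\<in>{..<n}. 1)" by simp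
      ultimately have "(Suc k, \<lambda>i\<in>{..<n}. 1) \<in> R" using R[OF XY(2)] t by metis
      then show ?thesis by (rule move[OF _ F F]) (use q in auto)
    qed
  qed
  moreover obtain k u where "r = (k, u)" "k < N" "u \<in> ?F" using r by (auto simp: states_def)
  moreover have "0 < q" using q by simp
  ultimately show ?thesis using move[OF _ F] by blast
qed

lemma pair_algebra_states:
  shows "is_ualgebra fd_arity (pair_algebra (letters n) states act)"
    and "generated_by_at_most fd_arity (pair_algebra (letters n) states act) (n + 2)"
    and "finite (universe (pair_algebra (letters n) states act))"
    and "N \<le> card (universe (pair_algebra (letters n) states act))"
proof -
  have fin: "finite (letters n)" and ne: "letters n \<noteq> {}" by (auto simp: letters_def)
  note card = card_letters[of n]
  have r0: "(0, \<lambda>i\<in>{..<n}. 0) \<in> states" using N q by (auto simp: states_def)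
  show "is_ualgebra fd_arity (pair_algebra (letters n) states act)"
    using ne r0 act_states by (intro is_ualgebra_pair_algebra) auto
  show "generated_by_at_most fd_arity (pair_algebra (letters n) states act) (n + 2)"
    by (rule generated_pair_algebra[OF fin ne _ act_states r0 states_reachable]) (simp_all add: card)
  show "finite (universe (pair_algebra (letters n) states act))"
    using fin finite_states by (simp add: pair_algebra_def)
  have "N \<le> (n + 2) * card states" using N_le_card_states by simp
  then show "N \<le> card (universe (pair_algebra (letters n) states act))"
    using card by (simp add: pair_algebra_def card_cartesian_product)
qed

end

section \<open>Two permutations of prime order with a long orbit\<close>

text \<open>Cyclic rotation inside each block of \<open>p\<close> consecutive numbers.\<close>

definition rot :: "nat \<Rightarrow> nat \<Rightarrow> nat" where
  "rot p k = p * (k div p) + (k + 1) mod p"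

lemma funpow_rot: "p > 0 \<Longrightarrow> (rot p ^^ m) k = p * (k div p) + (k + m) mod p"
  by (induction m) (auto simp: rot_def mod_simps)

text \<open>The second permutation is \<open>rot p\<close> conjugated by the cyclic shift of
  \<open>{..<N}\<close>, so its blocks are displaced by one. Inside a block \<open>rot p\<close>
  takes \<open>k\<close> to \<open>Suc k\<close>; at the end of a block \<open>k\<close> and
  \<open>Suc k\<close> share a displaced block because \<open>p \<ge> 2\<close>. Adding
  \<open>N\<close> before subtracting 1 gives the cyclic predecessor also at 0.\<close>

lemma letter_action_rot:
  assumes "q \<ge> 2" "p \<ge> 2" "l > 0"
  defines "N \<equiv> p * l"
  shows "letter_action q p N (rot p) (\<lambda>k. (rot p ((k + N - 1) mod N) + 1) mod N)"
proof -
  let ?t = "\<lambda>k. (rot p ((k + N - 1) mod N) + 1) mod N"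
  have N: "N \<ge> 2" using assms mult_le_mono[of 2 p 1 l] by simp
  have less: "rot p k < N" if "k < N" for k
  proof -
    have "k div p < l" using that assms by (simp add: less_mult_imp_div_less mult.commute)
    then have "p * (k div p + 1) \<le> N" unfolding N_def by (intro mult_le_mono2) simp
    moreover have "(k + 1) mod p < p" using assms by simp
    ultimately show ?thesis unfolding rot_def by (simp add: algebra_simps)
  qed
  have t: "(?t ^^ m) ((k + 1) mod N) = ((rot p ^^ m) k + 1) mod N" if "k < N" for m k
  proof (induction m)
    case (Suc m)
    have l: "(rot p ^^ m) k < N" using that less by (induction m) auto
    have "(((rot p ^^ m) k + 1) mod N + N - 1) mod N = (rot p ^^ m) k"
    proof (cases "(rot p ^^ m) k + 1 = N")
      case True
      then show ?thesis using N by simp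
    next
      case False
      then show ?thesis using l by simp
    qed
    then show ?case using Suc by simp
  qed simp
  show ?thesis
  proof
    fix k assume k: "k < N"
    have *: "((k + N - 1) mod N + 1) mod N = k" "(k + N - 1) mod N < N"
      using k N by (auto simp: mod_simps)
    show "rot p k < N" using less k .
    show "?t k < N" using N by simp
    show "(rot p ^^ p) k = k" using assms by (simp add: funpow_rot)
    show "(?t ^^ p) k = k"
      using t[of "(k + N - 1) mod N" p] * assms by (simp add: funpow_rot)
  next
    fix k assume k: "Suc k < N"
    show "rot p k = Suc k \<or> ?t k = Suc k"
    proof (cases "Suc (k mod p) = p")
      case False
      then have "(k + 1) mod p = k mod p + 1" by (simp add: mod_Suc)
      then show ?thesis by (simp add: rot_def)
    next
      case True
      then have "k > 0" using assms by (cases k) auto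
      then obtain j where j: "k = Suc j" by (cases k) auto
      \<comment> \<open>The predecessor of the end of a block is not itself an end, as blocks have
        at least two elements.\<close>
      have "Suc (j mod p) \<noteq> p" using True j assms by (auto simp: mod_Suc)
      then have "rot p j = Suc j" by (simp add: rot_def mod_Suc)
      moreover have "(k + N - 1) mod N = j" using j k by simp
      ultimately show ?thesis using j k by simp
    qed
  qed (use assms N in auto)
qed

section \<open>Word identities count hits\<close>

definition word_value :: "('a, 'm) monoid_scheme \<Rightarrow> ('v \<Rightarrow> 'a) \<Rightarrow> 'v list \<Rightarrow> 'a" where
  "word_value G \<sigma> w = foldr (\<lambda>v x. \<sigma> v \<otimes>\<^bsub>G\<^esub> x) w \<one>\<^bsub>G\<^esub>"

definition word_identity :: "('a, 'm) monoid_scheme \<Rightarrow> 'v list \<Rightarrow> 'v list \<Rightarrow> bool" where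
  "word_identity G w w' \<longleftrightarrow> (\<forall>\<sigma>. range \<sigma> \<subseteq> carrier G \<longrightarrow> word_value G \<sigma> w = word_value G \<sigma> w')"

text \<open>Equality of the values of both words in C_p wr C_q^n when \<open>l\<close> is sent to a
  generator of one copy of C_p, the other of \<open>X\<close> and \<open>Y\<close> to 1, and the
  \<open>Z i\<close> to the generators of C_q^n. The parameter \<open>c\<close> runs through the
  coordinates of the base group.\<close>

definition same_hits :: "nat \<Rightarrow> nat \<Rightarrow> letter list \<Rightarrow> letter list \<Rightarrow> bool" where
  "same_hits p q w w' \<longleftrightarrow>
    (\<forall>i. [count_list w (Z i) = count_list w' (Z i)] (mod q)) \<and>
    (\<forall>n l c. l = X \<or> l = Y \<longrightarrow>
      [hits l (\<lambda>v. \<forall>i<n. [count_list v (Z i) = c i] (mod q)) w =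
       hits l (\<lambda>v. \<forall>i<n. [count_list v (Z i) = c i] (mod q)) w'] (mod p))"

text \<open>The multiplicative counterpart of \<open>hits\<close>, with a weight \<open>f\<close> in
  place of a condition on the tail.\<close>

primrec suffix_prod :: "('a, 'm) monoid_scheme \<Rightarrow> 'l \<Rightarrow> ('l list \<Rightarrow> 'a) \<Rightarrow> 'l list \<Rightarrow> 'a" where
  "suffix_prod A l f [] = \<one>\<^bsub>A\<^esub>"
| "suffix_prod A l f (x # w) = (if x = l then f w else \<one>\<^bsub>A\<^esub>) \<otimes>\<^bsub>A\<^esub> suffix_prod A l f w"

lemma (in group) pow_eq_imp_cong_ord:
  assumes "x \<in> carrier G" "x [^] (m::nat) = x [^] (n::nat)"
  shows "[m = n] (mod ord x)"
proof -
  have "ord x dvd a - b" if "x [^] (a::nat) = x [^] b" for a b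
    using pow_eq_id[OF assms(1)] pow_eq_div2[OF assms(1) that] by simp
  from this[of m n] this[of n m] show ?thesis using assms(2)
    by (metis cong_altdef_nat cong_sym linear)
qed

section \<open>Products over suffixes in abelian groups\<close>

context comm_group
begin

lemma suffix_prod_closed:
  "(\<And>v. f v \<in> carrier G) \<Longrightarrow> suffix_prod G l f w \<in> carrier G"
  by (induction w) auto

lemma suffix_prod_hom:
  assumes "T \<in> hom G G" "\<And>v. f v \<in> carrier G"
  shows "T (suffix_prod G l f w) = suffix_prod G l (\<lambda>v. T (f v)) w"
proof -
  interpret group_hom G G T using assms(1) by (simp add: group_hom_def group_hom_axioms_def is_group)
  show ?thesis by (induction w) (auto simp: assms(2) suffix_prod_closed)
qed

lemma suffix_prod_finprod:
  assumes "finite I" "\<And>i v. f i v \<in> carrier G"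
  shows "finprod G (\<lambda>i. suffix_prod G l (f i) w) I = suffix_prod G l (\<lambda>v. finprod G (\<lambda>i. f i v) I) w"
  by (induction w) (auto simp: finprod_multf assms suffix_prod_closed Pi_def)

lemma suffix_prod_pow:
  assumes "\<And>v. f v \<in> carrier G"
  shows "suffix_prod G l (\<lambda>v. f v [^] (m::nat)) w = suffix_prod G l f w [^] m"
  by (induction w) (auto simp: assms suffix_prod_closed nat_pow_distrib)

lemma suffix_prod_indicator:
  assumes "a \<in> carrier G"
  shows "suffix_prod G l (\<lambda>v. if \<Phi> v then a else \<one>) w = a [^] hits l \<Phi> w"
  by (induction w) (auto simp: assms nat_pow_Suc2[OF assms, simplified] simp del: nat_pow_Suc)

text \<open>The order of \<open>x \<otimes> inv y\<close> divides both exponents. This is the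
  division by \<open>q\<close> in the Fourier inversion.\<close>

lemma eq_if_coprime_pow_eq:
  assumes xy: "x \<in> carrier G" "y \<in> carrier G" and p: "x [^] (p::nat) = \<one>" "y [^] p = \<one>"
    and q: "x [^] (q::nat) = y [^] q" and "coprime p q"
  shows "x = y"
proof -
  have z: "(x \<otimes> inv y) [^] (m::nat) = x [^] m \<otimes> inv (y [^] m)" for m
    using xy by (simp add: nat_pow_distrib nat_pow_inv)
  have "(x \<otimes> inv y) [^] p = \<one>" "(x \<otimes> inv y) [^] q = \<one>" using z[of p] z[of q] p q xy by simp_all
  then have "ord (x \<otimes> inv y) dvd gcd p q" using xy pow_eq_id by simp
  then have "ord (x \<otimes> inv y) = 1" using \<open>coprime p q\<close> by simp
  then have "x \<otimes> inv y = \<one>" using ord_eq_1 xy by simp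
  then show ?thesis using xy by (metis inv_equality inv_inv inv_closed)
qed

end

text \<open>
  \<open>\<alpha>\<close> plays the role of the powers of a nontrivial \<open>q\<close>-th root of unity: its sum over a period
  vanishes. Hence finite Fourier inversion over \<open>(\<int>/q)\<^sup>n\<close> recovers from the products of
  \<open>\<alpha> (c \<bullet> v)\<close>, for all frequencies \<open>c\<close>, how often each \<open>v\<close> modulo \<open>q\<close> occurs, modulo \<open>p\<close>.
\<close>

locale fourier_data = comm_group A for A (structure) +
  fixes \<alpha> :: "nat \<Rightarrow> 'a" and T :: "nat \<Rightarrow> 'a \<Rightarrow> 'a" and p q :: nat
  assumes \<alpha>_closed [simp]: "\<alpha> j \<in> carrier A"
    and \<alpha>_period: "\<alpha> (j + q) = \<alpha> j"
    and \<alpha>_sum: "finprod A \<alpha> {..<q} = \<one>"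
    and T_hom: "T t \<in> hom A A"
    and T_\<alpha>: "T t (\<alpha> j) = \<alpha> (t + j)"
    and exponent: "x \<in> carrier A \<Longrightarrow> x [^] p = \<one>"
    and p: "prime p" and q: "prime q" and pq: "p \<noteq> q"
    and \<alpha>_0: "\<alpha> 0 \<noteq> \<one>"
begin

lemma \<alpha>_mod: "\<alpha> (j mod q) = \<alpha> j"
proof -
  have "\<alpha> (i + q * m) = \<alpha> i" for i m
  proof (induction m)
    case (Suc m)
    then show ?case using \<alpha>_period[of "i + q * m"] by (simp add: algebra_simps)
  qed simp
  from this[of "j mod q" "j div q"] show ?thesis by simp
qed

lemma \<alpha>_cong: "[i = j] (mod q) \<Longrightarrow> \<alpha> i = \<alpha> j"
  using \<alpha>_mod[of i] \<alpha>_mod[of j] by (simp add: cong_def)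

text \<open>The orthogonality relation: if \<open>q\<close> does not divide \<open>\<delta>\<close>,
  the arguments run once through all residues modulo \<open>q\<close>, and
  \<open>\<alpha>_sum\<close> applies.\<close>

lemma finprod_progression:
  "finprod A (\<lambda>\<tau>. \<alpha> (S + \<tau> * \<delta>)) {..<q} = (if q dvd \<delta> then \<alpha> S [^] q else \<one>)"
proof (cases "q dvd \<delta>")
  case True
  have "\<alpha> (S + \<tau> * \<delta>) = \<alpha> S" for \<tau>
  proof (rule \<alpha>_cong)
    have "[\<tau> * \<delta> = 0] (mod q)" using True by (simp add: cong_0_iff)
    from cong_add[OF cong_refl[of S] this] show "[S + \<tau> * \<delta> = S] (mod q)" by simp
  qed
  then show ?thesis using True by (simp add: finprod_const)
next
  case False
  let ?h = "\<lambda>\<tau>. (S + \<tau> * \<delta>) mod q"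
  have q0: "q > 0" using q prime_gt_0_nat by blast
  have cop: "coprime \<delta> q" using False q by (metis coprime_commute prime_imp_coprime)
  have inj: "inj_on ?h {..<q}"
  proof (rule inj_onI)
    fix x y assume xy: "x \<in> {..<q}" "y \<in> {..<q}" "?h x = ?h y"
    then have "[S + x * \<delta> = S + y * \<delta>] (mod q)" by (simp add: cong_def)
    then have "[x * \<delta> = y * \<delta>] (mod q)" by (simp add: cong_add_lcancel_nat)
    then have "[x = y] (mod q)" using cop by (simp add: cong_mult_rcancel_nat)
    then show "x = y" using xy by (simp add: cong_def)
  qed
  have img: "?h ` {..<q} = {..<q}"
    using q0 by (intro endo_inj_surj[OF _ _ inj]) auto
  have "finprod A (\<lambda>\<tau>. \<alpha> (S + \<tau> * \<delta>)) {..<q} = finprod A (\<lambda>\<tau>. \<alpha> (?h \<tau>)) {..<q}"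
    using \<alpha>_mod by simp
  also have "\<dots> = finprod A \<alpha> (?h ` {..<q})" by (rule finprod_reindex[symmetric]) (auto simp: inj)
  finally show ?thesis using False \<alpha>_sum img by simp
qed

text \<open>Coordinates are inverted one at a time. \<open>F m c\<close> imposes the condition on
  the first \<open>m\<close> coordinates and keeps the frequencies \<open>c\<close> on the rest, so
  \<open>F 0\<close> is the hypothesis and \<open>F n\<close> is the weight that yields powers of
  \<open>\<alpha> 0\<close>. Combining all frequencies of coordinate \<open>m\<close> gives the
  \<open>q\<close>-th power of the product for \<open>Suc m\<close>, from which the
  \<open>q\<close>-th root can be taken.\<close>

lemma fourier_inversion:
  fixes n :: nat and cnt :: "nat \<Rightarrow> 'l list \<Rightarrow> nat"
  assumes eq: "\<And>c. suffix_prod A l (\<lambda>v. \<alpha> (\<Sum>i=0..<n. c i * cnt i v)) w =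
                    suffix_prod A l (\<lambda>v. \<alpha> (\<Sum>i=0..<n. c i * cnt i v)) w'"
  shows "[hits l (\<lambda>v. \<forall>i<n. [cnt i v = u i] (mod q)) w =
          hits l (\<lambda>v. \<forall>i<n. [cnt i v = u i] (mod q)) w'] (mod p)"
proof -
  define \<Phi> where "\<Phi> m v \<longleftrightarrow> (\<forall>i<m. [cnt i v = u i] (mod q))" for m v
  have \<Phi>_Suc: "\<Phi> (Suc m) v \<longleftrightarrow> \<Phi> m v \<and> [cnt m v = u m] (mod q)" for m v
    by (auto simp: \<Phi>_def less_Suc_eq)
  define F where "F m c v = (if \<Phi> m v
     then \<alpha> (\<Sum>i=m..<n. c i * cnt i v) else \<one>)" for m c v
  have Fc: "F m c v \<in> carrier A" for m c v by (simp add: F_def)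
  have "m \<le> n \<Longrightarrow> suffix_prod A l (F m c) w = suffix_prod A l (F m c) w'" for m c
  proof (induction m arbitrary: c)
    case 0
    have "F 0 c = (\<lambda>v. \<alpha> (\<Sum>i=0..<n. c i * cnt i v))" by (simp add: F_def \<Phi>_def fun_eq_iff)
    then show ?case using eq by simp
  next
    case (Suc m)
    then have m: "m < n" by simp
    \<comment> \<open>\<open>q - 1\<close> represents -1 modulo \<open>q\<close>. The shift by minus
      \<open>\<tau> * u m\<close> gives a progression whose step is divisible by \<open>q\<close>
      exactly if \<open>cnt m v\<close> is congruent to \<open>u m\<close>.\<close>
    let ?t = "\<lambda>\<tau>. \<tau> * (u m * (q - 1))"
    let ?f = "\<lambda>\<tau> v. T (?t \<tau>) (F m (c(m := \<tau>)) v)"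
    have T1: "T t \<one> = \<one>" for t using T_hom[of t] hom_one is_group by blast
    have f: "?f \<tau> v = (if \<Phi> m v
       then \<alpha> ((\<Sum>i=Suc m..<n. c i * cnt i v) + \<tau> * (cnt m v + u m * (q - 1))) else \<one>)" for \<tau> v
    proof -
      have "(\<Sum>i=m..<n. (c(m := \<tau>)) i * cnt i v) = \<tau> * cnt m v + (\<Sum>i=Suc m..<n. c i * cnt i v)"
        using m by (simp add: sum.atLeast_Suc_lessThan)
      then have "?t \<tau> + (\<Sum>i=m..<n. (c(m := \<tau>)) i * cnt i v)
          = (\<Sum>i=Suc m..<n. c i * cnt i v) + \<tau> * (cnt m v + u m * (q - 1))"
        by (simp only: add_mult_distrib2)
      then show ?thesis unfolding F_def by (cases "\<Phi> m v") (simp_all only: T_\<alpha> T1 if_True if_False)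
    qed
    have fc: "?f \<tau> v \<in> carrier A" for \<tau> v unfolding f by simp
    have q0: "q > 0" using q prime_gt_0_nat by blast
    have dvd: "q dvd cnt m v + u m * (q - 1) \<longleftrightarrow> [cnt m v = u m] (mod q)" for v
    proof -
      have "u m + u m * (q - 1) = u m * q" using q0 by (cases q) auto
      then have e: "[u m + u m * (q - 1) = 0] (mod q)" by (simp add: cong_def)
      have "[cnt m v = u m] (mod q) \<longleftrightarrow> [cnt m v + u m * (q - 1) = u m + u m * (q - 1)] (mod q)"
        by (simp add: cong_add_rcancel_nat)
      also have "\<dots> \<longleftrightarrow> [cnt m v + u m * (q - 1) = 0] (mod q)" using e cong_trans cong_sym by blast
      finally show ?thesis by (simp add: cong_0_iff)
    qed
    have fin: "finprod A (\<lambda>\<tau>. ?f \<tau> v) {..<q} = F (Suc m) c v [^] q" for v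
      unfolding f F_def[of "Suc m"] \<Phi>_Suc
      by (cases "\<Phi> m v"; cases "[cnt m v = u m] (mod q)")
        (simp_all only: finprod_progression dvd if_True if_False simp_thms finprod_one nat_pow_one)
    have pw: "suffix_prod A l (F (Suc m) c) x [^] q =
        finprod A (\<lambda>\<tau>. T (?t \<tau>) (suffix_prod A l (F m (c(m := \<tau>))) x)) {..<q}" for x
    proof -
      have "finprod A (\<lambda>\<tau>. T (?t \<tau>) (suffix_prod A l (F m (c(m := \<tau>))) x)) {..<q}
          = finprod A (\<lambda>\<tau>. suffix_prod A l (?f \<tau>) x) {..<q}"
        by (simp add: suffix_prod_hom[OF T_hom Fc])
      also have "\<dots> = suffix_prod A l (\<lambda>v. F (Suc m) c v [^] q) x"
        using suffix_prod_finprod[of "{..<q}" ?f l x] fc fin by simp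
      finally show ?thesis by (simp add: suffix_prod_pow Fc)
    qed
    have "suffix_prod A l (F (Suc m) c) w [^] q = suffix_prod A l (F (Suc m) c) w' [^] q"
      unfolding pw using Suc by simp
    moreover have "coprime p q" using p q pq primes_coprime by blast
    moreover have "suffix_prod A l (F (Suc m) c) v \<in> carrier A" for v
      by (rule suffix_prod_closed) (rule Fc)
    ultimately show ?case using eq_if_coprime_pow_eq[of _ _ p q] exponent by metis
  qed
  then have "suffix_prod A l (F n (\<lambda>_. 0)) w = suffix_prod A l (F n (\<lambda>_. 0)) w'" by simp
  moreover have "F n (\<lambda>_. 0) = (\<lambda>v. if \<Phi> n v then \<alpha> 0 else \<one>)" by (simp add: F_def fun_eq_iff)
  ultimately have e: "\<alpha> 0 [^] hits l (\<Phi> n) w = \<alpha> 0 [^] hits l (\<Phi> n) w'"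
    by (simp add: suffix_prod_indicator)
  \<comment> \<open>As \<open>\<alpha> 0\<close> has order \<open>p\<close>, equal powers of it have
    exponents congruent modulo \<open>p\<close>.\<close>
  have "ord (\<alpha> 0) dvd p" using exponent[of "\<alpha> 0"] pow_eq_id by simp
  moreover have "ord (\<alpha> 0) \<noteq> 1" using ord_eq_1 \<alpha>_0 by simp
  ultimately have "ord (\<alpha> 0) = p" using p prime_nat_iff by blast
  then have "[hits l (\<Phi> n) w = hits l (\<Phi> n) w'] (mod p)" using pow_eq_imp_cong_ord[OF _ e] by simp
  then show ?thesis unfolding \<Phi>_def .
qed

end

text \<open>Collecting the powers of \<open>inv g\<close> on the left conjugates each occurrence of
  \<open>a\<close> by the power of \<open>g\<close> that its tail determines.\<close>

lemma (in group) word_value_coprime_action: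
  fixes n :: nat and c :: "nat \<Rightarrow> nat" and l :: letter
  assumes a: "a \<in> carrier G" and g: "g \<in> carrier G" and A: "subgroup A G"
    and cl: "\<And>j. conj_by G (g [^] (j::nat)) a \<in> A" and l: "\<And>i. l \<noteq> Z i"
  defines "C \<equiv> \<lambda>v. \<Sum>i=0..<n. c i * count_list v (Z i)"
  shows "word_value G (\<lambda>v. if v = l then a else case v of Z i \<Rightarrow> if i < n then inv g [^] c i else \<one> | _ \<Rightarrow> \<one>) w
       = inv g [^] C w \<otimes> suffix_prod (G\<lparr>carrier := A\<rparr>) l (\<lambda>v. conj_by G (g [^] C v) a) w"
proof (induction w)
  case Nil
  then show ?case by (simp add: word_value_def C_def)
next
  case (Cons x w)
  let ?\<sigma> = "\<lambda>v. if v = l then a else case v of Z i \<Rightarrow> if i < n then inv g [^] c i else \<one> | _ \<Rightarrow> \<one>"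
  let ?R = "suffix_prod (G\<lparr>carrier := A\<rparr>) l (\<lambda>v. conj_by G (g [^] C v) a)"
  have "?R w \<in> A" by (induction w) (use cl subgroup.m_closed[OF A] subgroup.one_closed[OF A] in auto)
  then have R: "?R w \<in> carrier G" using A subgroup.mem_carrier by metis
  have v: "word_value G ?\<sigma> (x # w) = ?\<sigma> x \<otimes> (inv g [^] C w \<otimes> ?R w)"
    using Cons by (simp add: word_value_def)
  show ?case
  proof (cases "x = l")
    case True
    have C: "C (x # w) = C w" using True l by (simp add: C_def)
    have "inv g [^] C w \<otimes> (conj_by G (g [^] C w) a \<otimes> ?R w) = a \<otimes> (inv g [^] C w \<otimes> ?R w)"
      using a g R by (simp add: conj_by_def nat_pow_inv m_assoc[symmetric])
    then show ?thesis unfolding v using True C by simp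
  next
    case False
    have R': "?R (x # w) = ?R w" using False R by simp
    show ?thesis
    proof (cases "\<exists>i<n. x = Z i")
      case True
      then obtain i where i: "i < n" "x = Z i" by blast
      have "C (x # w) = (\<Sum>j=0..<n. (if j = i then c i else 0) + c j * count_list w (Z j))"
        unfolding C_def using i(2) by (intro sum.cong) auto
      also have "\<dots> = c i + C w" unfolding C_def sum.distrib using i(1) by simp
      finally have "C (x # w) = c i + C w" .
      then show ?thesis unfolding v R' using i False g R
        by (simp add: m_assoc[symmetric] nat_pow_mult)
    next
      case False': False
      then have "?\<sigma> x = \<one>" using False by (cases x) auto
      moreover have "C (x # w) = C w" unfolding C_def using False' by (intro sum.cong) auto
      ultimately show ?thesis unfolding v R' using g R by simp
    qed
  qed
qed

lemma (in group) word_value_closed: "range \<sigma> \<subseteq> carrier G \<Longrightarrow> word_value G \<sigma> w \<in> carrier G"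
  by (induction w) (auto simp: word_value_def)

text \<open>The conjugates of the commutator \<open>a\<close> of \<open>g\<close> and
  \<open>a0\<close> telescope over a period, which provides the Fourier data on \<open>A\<close>. An
  identity is evaluated with \<open>l\<close> sent to \<open>a\<close> and once more with
  \<open>l\<close> sent to 1. The second evaluation isolates the power of \<open>inv g\<close>;
  after its cancellation the suffix products agree for every choice of frequencies.\<close>

lemma (in group) word_identity_imp_cong:
  assumes fin: "finite (carrier G)" and nontriv: "carrier G \<noteq> {\<one>}"
    and cl: "centreless G" and psn: "proper_subgroups_nilpotent G"
  shows "\<exists>p q. prime p \<and> prime q \<and> (\<forall>w w'. word_identity G w w' \<longrightarrow> same_hits p q w w')"
proof -
  obtain A p q k g a0 where A: "A \<lhd> G" "prime p" "prime q" "p \<noteq> q"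
    "\<And>x. x \<in> A \<Longrightarrow> x [^] (p::nat) = \<one>" "\<And>x y. x \<in> A \<Longrightarrow> y \<in> A \<Longrightarrow> x \<otimes> y = y \<otimes> x"
    and a0: "a0 \<in> A" and g: "g \<in> carrier G" "g [^] (q ^ k :: nat) = \<one>"
      "g \<otimes> a0 \<noteq> a0 \<otimes> g" "g [^] q \<otimes> a0 = a0 \<otimes> g [^] q"
    by (rule coprime_action_ex[OF assms], rule that)
  interpret A: normal A G by (rule A(1))
  have sA: "subgroup A G" by (rule A.is_subgroup)
  let ?A = "G\<lparr>carrier := A\<rparr>"
  have Ac: "x \<in> carrier G" if "x \<in> A" for x using A.mem_carrier[OF that] .
  have conjA: "conj_by G h x \<in> A" if "h \<in> carrier G" "x \<in> A" for h x
    unfolding conj_by_def using A.inv_op_closed2[OF that] .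
  define a where "a = conj_by G g a0 \<otimes> inv a0"
  define \<alpha> where "\<alpha> j = conj_by G (g [^] (j::nat)) a" for j
  have a0c: "a0 \<in> carrier G" using a0 Ac by blast
  have aA: "a \<in> A" unfolding a_def using conjA g(1) a0 by simp
  have ac: "a \<in> carrier G" using aA Ac by blast
  have a1: "a \<noteq> \<one>"
  proof
    assume "a = \<one>"
    then have "conj_by G g a0 = a0"
      unfolding a_def using g(1) a0c by (metis conj_by_closed inv_closed inv_equality inv_inv)
    then show False using conj_by_eq_iff[OF g(1) a0c] g(3) by simp
  qed
  have \<alpha>A: "\<alpha> j \<in> A" for j unfolding \<alpha>_def using conjA g(1) aA by simp
  have conj_q: "conj_by G (g [^] q) a0 = a0" using conj_by_eq_iff g a0c by simp
  have comm: "comm_group ?A"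
    by (rule group.group_comm_groupI[OF subgroup_imp_group[OF sA]]) (simp add: A(6))
  interpret AA: comm_group ?A by (rule comm)
  have fourier: "fourier_data ?A \<alpha> (\<lambda>t. conj_by G (g [^] t)) p q"
  proof (intro fourier_data.intro comm fourier_data_axioms.intro)
    show "\<alpha> j \<in> carrier ?A" for j using \<alpha>A by simp
    \<comment> \<open>\<open>g [^] q\<close> commutes with \<open>g\<close> and with
      \<open>a0\<close>, hence with \<open>a\<close>.\<close>
    show "\<alpha> (j + q) = \<alpha> j" for j
    proof -
      have "conj_by G (g [^] q) a = conj_by G (g [^] q) (conj_by G g a0) \<otimes> inv (conj_by G (g [^] q) a0)"
        unfolding a_def using g(1) a0c by (simp add: conj_by_m conj_by_inv)
      also have "conj_by G (g [^] q) (conj_by G g a0) = conj_by G g (conj_by G (g [^] q) a0)"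
        using g(1) a0c by (simp add: conj_by_conj_by) (metis nat_pow_Suc nat_pow_Suc2)
      finally have "conj_by G (g [^] q) a = a" using conj_q by (simp add: a_def)
      then show ?thesis
        unfolding \<alpha>_def using g(1) ac by (simp add: nat_pow_mult[symmetric] conj_by_conj_by[symmetric])
    qed
    have inv_mult_cancel: "inv y \<otimes> (y \<otimes> x) = x" if "y \<in> carrier G" "x \<in> carrier G" for x y
      using that by (simp add: m_assoc[symmetric])
    have tel: "finprod ?A \<alpha> {..<m} = conj_by G (g [^] m) a0 \<otimes> inv a0" for m :: nat
    proof (induction m)
      case 0
      then show ?case using a0c by simp
    next
      case (Suc m)
      have "finprod ?A \<alpha> {..<Suc m} = \<alpha> m \<otimes> finprod ?A \<alpha> {..<m}"
        unfolding lessThan_Suc using AA.finprod_insert[of "{..<m}" m \<alpha>] \<alpha>A by simp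
      also have "\<alpha> m = conj_by G (g [^] Suc m) a0 \<otimes> inv (conj_by G (g [^] m) a0)"
        unfolding \<alpha>_def a_def using g(1) a0c by (simp add: conj_by_m conj_by_inv conj_by_conj_by)
      finally show ?case using Suc g(1) a0c inv_mult_cancel by (simp add: m_assoc)
    qed
    show "finprod ?A \<alpha> {..<q} = \<one>\<^bsub>?A\<^esub>" using tel[of q] conj_q a0c by simp
    show "conj_by G (g [^] t) \<in> hom ?A ?A" for t :: nat
      using g(1) conjA Ac by (auto simp: hom_def conj_by_m)
    show "conj_by G (g [^] t) (\<alpha> j) = \<alpha> (t + j)" for t j
      unfolding \<alpha>_def using g(1) ac by (simp add: conj_by_conj_by nat_pow_mult)
    show "x [^]\<^bsub>?A\<^esub> p = \<one>\<^bsub>?A\<^esub>" if "x \<in> carrier ?A" for x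
      using that A(5) nat_pow_consistent[of x p A] by simp
    show "prime p" "prime q" "p \<noteq> q" using A by auto
    show "\<alpha> 0 \<noteq> \<one>\<^bsub>?A\<^esub>" using a1 ac by (simp add: \<alpha>_def)
  qed
  interpret F: fourier_data ?A \<alpha> "\<lambda>t. conj_by G (g [^] t)" p q by (rule fourier)
  have main: "same_hits p q w w'"
    if id: "word_identity G w w'" for w w' :: "letter list"
    unfolding same_hits_def
  proof (intro conjI allI impI)
    fix i
    \<comment> \<open>Sending all other letters to 1 leaves a power of \<open>g\<close>, and the
      order of \<open>g\<close> is a nontrivial power of \<open>q\<close>.\<close>
    let ?\<sigma> = "\<lambda>v. if v = Z i then g else \<one>"
    have e: "word_value G ?\<sigma> w = g [^] count_list w (Z i)" for w
      by (induction w) (use g(1) in \<open>simp_all add: word_value_def nat_pow_Suc2[symmetric] del: nat_pow_Suc\<close>)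
    have "range ?\<sigma> \<subseteq> carrier G" using g(1) by auto
    then have "g [^] count_list w (Z i) = g [^] count_list w' (Z i)"
      using id e unfolding word_identity_def by metis
    then have c: "[count_list w (Z i) = count_list w' (Z i)] (mod ord g)"
      using pow_eq_imp_cong_ord g(1) by blast
    have "ord g dvd q ^ k" using pow_eq_id g by blast
    moreover have "ord g \<noteq> 1" using ord_eq_1[OF g(1)] g(3) a0c by auto
    ultimately have "q dvd ord g"
      using A(3) by (metis divides_primepow_nat dvd_power gr0I power_0)
    then show "[count_list w (Z i) = count_list w' (Z i)] (mod q)"
      by (rule cong_dvd_modulus_nat[OF c])
  next
    fix n :: nat and l :: letter and u :: "nat \<Rightarrow> nat"
    assume l: "l = X \<or> l = Y"
    show "[hits l (\<lambda>v. \<forall>i<n. [count_list v (Z i) = u i] (mod q)) w =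
       hits l (\<lambda>v. \<forall>i<n. [count_list v (Z i) = u i] (mod q)) w'] (mod p)"
    proof (rule F.fourier_inversion)
      fix c :: "nat \<Rightarrow> nat"
      let ?C = "\<lambda>v. \<Sum>i=0..<n. c i * count_list v (Z i)"
      let ?\<sigma> = "\<lambda>x v. if v = l then x else case v of Z i \<Rightarrow> if i < n then inv g [^] c i else \<one> | _ \<Rightarrow> \<one>"
      have r: "range (?\<sigma> x) \<subseteq> carrier G" if "x \<in> carrier G" for x
        using that g(1) by (auto split: letter.splits)
      have idv: "word_value G (?\<sigma> x) w = word_value G (?\<sigma> x) w'" if "x \<in> carrier G" for x
        using id r[OF that] unfolding word_identity_def by blast
      have lZ: "l \<noteq> Z i" for i using l by auto
      have val: "word_value G (?\<sigma> a) v = inv g [^] ?C v \<otimes> suffix_prod ?A l (\<lambda>v. \<alpha> (?C v)) v" for v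
        using word_value_coprime_action[OF ac g(1) sA _ lZ, of n c v] \<alpha>A unfolding \<alpha>_def by blast
      have val1: "word_value G (?\<sigma> \<one>) v = inv g [^] ?C v" for v
      proof -
        have s: "suffix_prod ?A l (\<lambda>v. \<one>) v = \<one>" by (induction v) auto
        have "\<one> \<in> A" by simp
        then show ?thesis
          using word_value_coprime_action[OF one_closed g(1) sA _ lZ, of n c v] g(1) s by simp
      qed
      have e1: "inv g [^] ?C w = inv g [^] ?C w'"
        using idv[OF one_closed] unfolding val1 .
      have "inv g [^] ?C w \<otimes> suffix_prod ?A l (\<lambda>v. \<alpha> (?C v)) w =
            inv g [^] ?C w' \<otimes> suffix_prod ?A l (\<lambda>v. \<alpha> (?C v)) w'"
        using idv[OF ac] unfolding val .
      moreover have "suffix_prod ?A l (\<lambda>v. \<alpha> (?C v)) v \<in> carrier G" for v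
        using AA.suffix_prod_closed[of "\<lambda>v. \<alpha> (?C v)" l v] \<alpha>A Ac by simp
      ultimately show "suffix_prod ?A l (\<lambda>v. \<alpha> (?C v)) w = suffix_prod ?A l (\<lambda>v. \<alpha> (?C v)) w'"
        unfolding e1 using g(1) by simp
    qed
  qed
  then show ?thesis using A(2,3) by blast
qed

section \<open>Word identities pass to sections\<close>

lemma (in group) word_identity_subgroup:
  fixes w w' :: "'v list"
  assumes "subgroup H G" "word_identity G w w'"
  shows "word_identity (G\<lparr>carrier := H\<rparr>) w w'"
  unfolding word_identity_def
proof (intro allI impI)
  fix \<sigma> :: "'v \<Rightarrow> 'a" assume "range \<sigma> \<subseteq> carrier (G\<lparr>carrier := H\<rparr>)"
  then have "range \<sigma> \<subseteq> carrier G" using subgroup.subset[OF assms(1)] by simp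
  then have "word_value G \<sigma> w = word_value G \<sigma> w'" using assms(2) unfolding word_identity_def by blast
  then show "word_value (G\<lparr>carrier := H\<rparr>) \<sigma> w = word_value (G\<lparr>carrier := H\<rparr>) \<sigma> w'"
    by (simp add: word_value_def)
qed

lemma word_identity_hom_image:
  fixes w w' :: "'v list"
  assumes "group_hom G H h" and surj: "h ` carrier G = carrier H" and id: "word_identity G w w'"
  shows "word_identity H w w'"
  unfolding word_identity_def
proof (intro allI impI)
  interpret group_hom G H h by fact
  fix \<sigma> :: "'v \<Rightarrow> _" assume \<sigma>: "range \<sigma> \<subseteq> carrier H"
  then have "\<forall>v. \<exists>x. x \<in> carrier G \<and> h x = \<sigma> v" using surj by (metis UNIV_I image_iff subset_iff)
  then obtain \<tau> where \<tau>: "\<And>v. \<tau> v \<in> carrier G" "\<And>v. h (\<tau> v) = \<sigma> v" by metis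
  then have r: "range \<tau> \<subseteq> carrier G" by auto
  have "word_value H \<sigma> v = h (word_value G \<tau> v)" for v
  proof (induction v)
    case (Cons x v)
    then show ?case using \<tau> G.word_value_closed[OF r, of v] by (simp add: word_value_def)
  qed (simp add: word_value_def)
  then show "word_value H \<sigma> w = word_value H \<sigma> w'"
    using id r unfolding word_identity_def by metis
qed

lemma (in group) nonnilpotent_word_identity_imp_cong:
  assumes fin: "finite (carrier G)" and nn: "\<not> nilpotent_group G"
  shows "\<exists>p q. prime p \<and> prime q \<and> (\<forall>w w'. word_identity G w w' \<longrightarrow> same_hits p q w w')"
proof -
  obtain H where H: "subgroup H G" "\<not> nilpotent_group (G\<lparr>carrier := H\<rparr>)"
    "proper_subgroups_nilpotent (G\<lparr>carrier := H\<rparr>)"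
    using minimal_nonnilpotent_subgroup[OF assms] by blast
  let ?H = "G\<lparr>carrier := H\<rparr>"
  interpret H: group ?H by (rule subgroup_imp_group[OF H(1)])
  have finH: "finite (carrier ?H)" using H(1) fin subgroup.subset finite_subset by fastforce
  obtain M where M: "M \<lhd> ?H" "carrier (?H Mod M) \<noteq> {\<one>\<^bsub>?H Mod M\<^esub>}" "centreless (?H Mod M)"
    "proper_subgroups_nilpotent (?H Mod M)"
    using H.centreless_quotient[OF finH H(2,3)] by blast
  interpret M: normal M ?H by (rule M(1))
  have Q: "group (?H Mod M)" by (rule M.factorgroup_is_group)
  have hom: "group_hom ?H (?H Mod M) (\<lambda>x. M #>\<^bsub>?H\<^esub> x)"
    using M.r_coset_hom_Mod Q by (simp add: group_hom_def group_hom_axioms_def H.is_group)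
  have surj: "(\<lambda>x. M #>\<^bsub>?H\<^esub> x) ` carrier ?H = carrier (?H Mod M)"
    by (auto simp: FactGroup_def RCOSETS_def)
  have "finite (carrier (?H Mod M))" unfolding surj[symmetric] using finH by (rule finite_imageI)
  from group.word_identity_imp_cong[OF Q this M(2-4)]
  obtain p q where pq: "prime p" "prime q"
    "\<And>w w'. word_identity (?H Mod M) w w' \<Longrightarrow> same_hits p q w w'" by blast
  have "same_hits p q w w'" if "word_identity G w w'" for w w'
    by (rule pq(3)[OF word_identity_hom_image[OF hom surj word_identity_subgroup[OF H(1) that]]])
  then show ?thesis using pq(1,2) by blast
qed

section \<open>Identities of the algebra of a faithful action\<close>

text \<open>There is only one extensional function on the empty set.\<close>

lemma faithful_action_nonempty:
  assumes "faithful_action G S \<alpha>" "carrier G \<noteq> {\<one>\<^bsub>G\<^esub>}" "group G"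
  shows "S \<noteq> {}"
proof
  assume S: "S = {}"
  interpret faithful_action G S \<alpha> by fact
  interpret group G by fact
  have "\<alpha> g = \<alpha> \<one>\<^bsub>G\<^esub>" if "g \<in> carrier G" for g
  proof (rule extensionalityI)
    show "\<alpha> g \<in> extensional S" "\<alpha> \<one>\<^bsub>G\<^esub> \<in> extensional S"
      using bij_prop0[OF that] bij_prop0[OF one_closed] by (auto simp: Bij_def)
  qed (simp add: S)
  then have "g = \<one>\<^bsub>G\<^esub>" if "g \<in> carrier G" for g
    using that faithful one_closed by (metis inj_onD)
  then show False using assms(2) by auto
qed

text \<open>The adjoined zeros detect heads and tails: a zero assigned to a single variable shows in
  the value precisely when that variable is the head, or the tail if all first components are 1.
  With nonzero values throughout, the words act on \<open>S\<close>, and faithfulness turns equal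
  actions into equal elements of \<open>G\<close>.\<close>

lemma satisfies_identity_action_algebra:
  fixes s t :: "(fd_symbol, 'v) uterm" and S :: "'s set"
  assumes G: "group G" and act: "faithful_action G S \<alpha>" and S: "S \<noteq> {}"
    and id: "satisfies_identity (action_algebra G S \<alpha>) s t"
    and wf: "wf_uterm fd_arity s" "wf_uterm fd_arity t"
  shows "term_head s = term_head t" "term_tail s = term_tail t"
    "word_identity G (term_word s) (term_word t)"
proof -
  interpret group G by (rule G)
  interpret faithful_action G S \<alpha> by (rule act)
  let ?act = "\<lambda>\<rho> w x. foldr (\<lambda>v. action_zero \<alpha> (fst (\<rho> v))) w x"
  have ev: "fst (\<rho> (term_head s)) = fst (\<rho> (term_head t))"
    "?act \<rho> (term_word s) (snd (\<rho> (term_tail s))) = ?act \<rho> (term_word t) (snd (\<rho> (term_tail t)))"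
    if \<rho>: "\<And>v. fst (\<rho> v) \<in> with_zero (carrier G)" "\<And>v. snd (\<rho> v) \<in> with_zero S" for \<rho>
  proof -
    have "range \<rho> \<subseteq> universe (action_algebra G S \<alpha>)"
      using \<rho> by (intro image_subsetI) (simp add: action_algebra_def mem_Times_iff)
    then have "eval_uterm (action_algebra G S \<alpha>) \<rho> s = eval_uterm (action_algebra G S \<alpha>) \<rho> t"
      using id unfolding satisfies_identity_def by blast
    then show "fst (\<rho> (term_head s)) = fst (\<rho> (term_head t))"
      "?act \<rho> (term_word s) (snd (\<rho> (term_tail s))) = ?act \<rho> (term_word t) (snd (\<rho> (term_tail t)))"
      unfolding action_algebra_eq_pair_algebra eval_pair_algebra[OF wf(1)] eval_pair_algebra[OF wf(2)]
      by simp_all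
  qed
  have val: "?act \<rho> w (Some x) = Some (\<alpha> (word_value G \<sigma> w) x)"
    if \<sigma>: "\<And>v. \<sigma> v \<in> carrier G" "\<And>v. fst (\<rho> v) = Some (\<sigma> v)" and x: "x \<in> S" for \<rho> \<sigma> w x
  proof (induction w)
    case Nil
    have "\<alpha> \<one>\<^bsub>G\<^esub> x = x" using id_eq_one x by (metis restrict_apply')
    then show ?case by (simp add: word_value_def)
  next
    case (Cons v w)
    have "word_value G \<sigma> w \<in> carrier G" using word_value_closed \<sigma>(1) by (metis image_subsetI)
    then show ?case using Cons \<sigma> x composition_rule by (simp add: word_value_def)
  qed
  have None: "?act \<rho> w None = None" for \<rho> w
    by (induction w) auto
  show "term_head s = term_head t"
  proof (rule ccontr)
    assume ne: "term_head s \<noteq> term_head t"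
    let ?\<rho> = "\<lambda>v. (if v = term_head s then None else Some \<one>\<^bsub>G\<^esub>, None :: 's option)"
    have "fst (?\<rho> (term_head s)) = fst (?\<rho> (term_head t))"
      by (rule ev(1)[of ?\<rho>]) (simp_all add: with_zero_def)
    then show False using ne by simp
  qed
  obtain x where x: "x \<in> S" using S by blast
  show "term_tail s = term_tail t"
  proof (rule ccontr)
    assume ne: "term_tail s \<noteq> term_tail t"
    let ?\<rho> = "\<lambda>v. (Some \<one>\<^bsub>G\<^esub>, if v = term_tail s then None else Some x)"
    have "?act ?\<rho> (term_word t) (Some x) = Some (\<alpha> (word_value G (\<lambda>_. \<one>\<^bsub>G\<^esub>) (term_word t)) x)"
      by (rule val[of "\<lambda>_. \<one>\<^bsub>G\<^esub>" ?\<rho>]) (simp_all add: x)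
    moreover have "?act ?\<rho> (term_word s) (snd (?\<rho> (term_tail s)))
        = ?act ?\<rho> (term_word t) (snd (?\<rho> (term_tail t)))"
      by (rule ev(2)[of ?\<rho>]) (simp_all add: with_zero_def x)
    ultimately show False using None[of ?\<rho> "term_word s"] ne by simp
  qed
  show "word_identity G (term_word s) (term_word t)"
    unfolding word_identity_def
  proof (intro allI impI)
    fix \<sigma> :: "'v \<Rightarrow> _" assume \<sigma>: "range \<sigma> \<subseteq> carrier G"
    let ?W = "word_value G \<sigma>"
    have W: "?W w \<in> carrier G" for w by (rule word_value_closed[OF \<sigma>])
    have "\<alpha> (?W (term_word s)) = \<alpha> (?W (term_word t))"
    proof (rule extensionalityI)
      show "\<alpha> (?W (term_word s)) \<in> extensional S" "\<alpha> (?W (term_word t)) \<in> extensional S"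
        using bij_prop0[OF W] by (auto simp: Bij_def)
      fix y assume y: "y \<in> S"
      let ?\<rho> = "\<lambda>v. (Some (\<sigma> v), Some y)"
      have "?act ?\<rho> w (Some y) = Some (\<alpha> (?W w) y)" for w
        by (rule val[of \<sigma> ?\<rho>]) (use \<sigma> y in auto)
      moreover have "?act ?\<rho> (term_word s) (snd (?\<rho> (term_tail s)))
          = ?act ?\<rho> (term_word t) (snd (?\<rho> (term_tail t)))"
        by (rule ev(2)[of ?\<rho>]) (use \<sigma> y in \<open>auto simp: with_zero_def\<close>)
      ultimately show "\<alpha> (?W (term_word s)) y = \<alpha> (?W (term_word t)) y" by simp
    qed
    then show "?W (term_word s) = ?W (term_word t)" using faithful W by (metis inj_onD)
  qed
qed

text \<open>Serves to replace variables by the letters assigned to them; distinct variables may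
  receive the same letter.\<close>

lemma word_identity_map:
  fixes f :: "'v \<Rightarrow> 'u"
  assumes "word_identity G w w'"
  shows "word_identity G (map f w) (map f w')"
proof -
  have "word_value G \<sigma> (map f v) = word_value G (\<sigma> \<circ> f) v" for \<sigma> :: "'u \<Rightarrow> _" and v
    by (simp add: word_value_def foldr_map comp_def)
  moreover have "range (\<sigma> \<circ> f) \<subseteq> carrier G" if "range \<sigma> \<subseteq> carrier G" for \<sigma> :: "'u \<Rightarrow> _" using that by auto
  ultimately show ?thesis using assms unfolding word_identity_def by metis
qed

lemma finite_uterm_vars: "finite (uterm_vars t)"
  by (induction t) auto

theorem theorem5p2:
  fixes G :: "('g, 'm) monoid_scheme" and S :: "'s set" and \<alpha> :: "'g \<Rightarrow> 's \<Rightarrow> 's"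
  assumes "group G" and "finite (carrier G)" and "\<not> nilpotent_group G"
    and "finite S" and "faithful_action G S \<alpha>"
  shows "inherently_nonfinitely_based_in_finite_sense fd_arity (action_algebra G S \<alpha>)"
proof (rule inherently_nonfinitely_based_in_finite_senseI)
  interpret group G by fact
  have "carrier G \<noteq> {\<one>\<^bsub>G\<^esub>}"
  proof
    assume "carrier G = {\<one>\<^bsub>G\<^esub>}"
    then have "lower_central_series G 0 = {\<one>\<^bsub>G\<^esub>}" by simp
    then show False using assms(1,3) unfolding nilpotent_group_def by blast
  qed
  then have S: "S \<noteq> {}" using faithful_action_nonempty assms(1,5) by blast
  obtain p q where p: "prime p" and q: "prime q" and pq: "\<And>w w'. word_identity G w w' \<Longrightarrow> same_hits p q w w'"
    using nonnilpotent_word_identity_imp_cong[OF assms(2,3)] by blast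
  fix n :: nat assume n: "n \<ge> 1"
  have "\<exists>B :: (fd_symbol, letter \<times> nat \<times> (nat \<Rightarrow> nat)) ualgebra.
      in_variety_upto fd_arity n (action_algebra G S \<alpha>) B \<and> finite (universe B) \<and>
      generated_by_at_most fd_arity B (n + 2) \<and> l \<le> card (universe B)" if l: "l > 0" for l
  proof -
    \<comment> \<open>A multiple of \<open>p\<close>, so that blocks of length \<open>p\<close> fill
      \<open>{..<N}\<close>, and at least \<open>l\<close>.\<close>
    define N where "N = p * l"
    interpret letter_action n q p N "rot p" "\<lambda>k. (rot p ((k + N - 1) mod N) + 1) mod N"
      unfolding N_def
      by (rule letter_action_rot) (use l prime_ge_2_nat[OF p] prime_ge_2_nat[OF q] in auto)
    let ?B = "pair_algebra (letters n) states act"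
    have "satisfies_identity ?B s t"
      if wf: "wf_uterm fd_arity s" "wf_uterm fd_arity t"
        and card: "card (uterm_vars s \<union> uterm_vars t) \<le> n"
        and id: "satisfies_identity (action_algebra G S \<alpha>) s t" for s t :: "(fd_symbol, nat) uterm"
      unfolding satisfies_identity_def
    proof (intro allI impI)
      fix \<rho> :: "nat \<Rightarrow> letter \<times> nat \<times> (nat \<Rightarrow> nat)" assume \<rho>: "range \<rho> \<subseteq> universe ?B"
      note st = satisfies_identity_action_algebra[OF assms(1,5) S id wf]
      have \<rho>': "fst (\<rho> v) \<in> letters n" "snd (\<rho> v) \<in> states" for v
      proof -
        have "\<rho> v \<in> letters n \<times> states" using \<rho> by (auto simp: pair_algebra_def)
        then show "fst (\<rho> v) \<in> letters n" "snd (\<rho> v) \<in> states" by (simp_all add: mem_Times_iff)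
      qed
      let ?\<pi> = "fst \<circ> \<rho>"
      let ?V = "uterm_vars s \<union> uterm_vars t"
      let ?ws = "map ?\<pi> (term_word s)" and ?wt = "map ?\<pi> (term_word t)"
      have fl: "foldr (\<lambda>v. act (fst (\<rho> v))) w r = foldr act (map ?\<pi> w) r" for w r
        by (simp add: foldr_map comp_def)
      \<comment> \<open>At most \<open>n\<close> of the \<open>n + 2\<close> letters are assigned,
        so some letter is absent from both words.\<close>
      have "card (?\<pi> ` ?V) \<le> n"
        using card card_image_le[of ?V ?\<pi>] finite_uterm_vars by (metis finite_Un le_trans)
      then have "?\<pi> ` ?V \<noteq> letters n" using card_letters[of n] by auto
      then have L: "?\<pi> ` ?V \<subset> letters n" using \<rho>'(1) by auto
      have idw: "word_identity G ?ws ?wt" by (rule word_identity_map[OF st(3)])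
      have "foldr act ?ws r = foldr act ?wt r" if r: "r \<in> states" for r
      proof (rule foldr_act_eq[OF _ _ L r])
        show "set ?ws \<subseteq> ?\<pi> ` ?V" "set ?wt \<subseteq> ?\<pi> ` ?V"
          using term_vars_subset(3)[OF wf(1)] term_vars_subset(3)[OF wf(2)] by auto
      qed (use pq[OF idw, unfolded same_hits_def] in blast)+
      then show "eval_uterm ?B \<rho> s = eval_uterm ?B \<rho> t"
        unfolding eval_pair_algebra[OF wf(1)] eval_pair_algebra[OF wf(2)] fl st(1,2)
        using \<rho>'(2) by simp
    qed
    then have "in_variety_upto fd_arity n (action_algebra G S \<alpha>) ?B"
      unfolding in_variety_upto_def using pair_algebra_states(1) by blast
    moreover have "l \<le> N" using prime_ge_1_nat[OF p] by (simp add: N_def)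
    ultimately show ?thesis
      using pair_algebra_states(2-4) le_trans by blast
  qed
  then show "\<exists>d\<ge>1. \<forall>l>0. \<exists>B :: (fd_symbol, letter \<times> nat \<times> (nat \<Rightarrow> nat)) ualgebra.
      in_variety_upto fd_arity n (action_algebra G S \<alpha>) B \<and> finite (universe B) \<and>
      generated_by_at_most fd_arity B d \<and> l \<le> card (universe B)"
    by (intro exI[of _ "n + 2"]) auto
qed

end
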